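(* Let $G$ and $H$ be graphs of orders $N_1$ and $N_2$, respectively, each with at least one edge, let $G\boxtimes H$ denote their strong product, and define $$r(G,H)=\frac{N_1}{\mathcal E(G)}+\frac{N_2}{\mathcal E(H)}.$$ Then $$\mathcal E(G\boxtimes H)\geq\mathcal E(G)\mathcal E(H)\bigl(1-r(G,H)\bigr).$$ If the orders are coprime and $r(G,H)<1$, then $$\kappa(G\boxtimes H)\leq\kappa(G)\kappa(H)\frac{1+r(G,H)}{1-r(G,H)}.$$
   Context: Graphs are finite, simple and undirected; $s_G$ denotes the number of edges of $G$. The weak product $G\times H$ has vertex set $V(G)\times V(H)$, with $(g_1,h_1)$ adjacent to $(g_2,h_2)$ if and only if $g_1$ is adjacent to $g_2$ in $G$ and $h_1$ is adjacent to $h_2$ in $H$. The Cartesian product $G\square H$ has the same vertex set, with $(g_1,h_1)$ adjacent to $(g_2,h_2)$ if and only if either $g_1=g_2$ and $h_1$ is adjacent to $h_2$, or $h_1=h_2$ and $g_1$ is adjacent to $g_2$. The strong product $G\boxtimes H$ is the union of the weak and Cartesian products on the common vertex set $V(G)\times V(H)$. A vertex labeling of a graph $G=(V,E)$ of order $N=|V|$ is a bijection $\sigma:V\to\mathbb Z_N=\mathbb Z/N\mathbb Z$. The adjacency matrix under $\sigma$ is the $N\times N$ matrix $A_\sigma$, indexed by $\mathbb Z_N\times\mathbb Z_N$, with $(A_\sigma)_{x,y}=1$ if the vertices labeled $x$ and $y$ are adjacent and $0$ otherwise. $F$ is the unitary Fourier matrix $F_{mx}=\frac1{\sqrt N}e^{-2\pi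 i mx/N}$. The Fourier ratio of a nonzero $N\times N$ matrix $M$ is $\operatorname{FR}(M)=\|FMF\|_1/\|FMF\|_2$, where $\|\cdot\|_1$ is the entrywise $\ell^1$-norm and $\|\cdot\|_2$ the Frobenius norm. The edge complexity of a graph with at least one edge is $\operatorname{FR}_{\min}(G)=\min_\sigma\operatorname{FR}(A_\sigma)$, the minimum over all vertex labelings (by $\mathbb Z_N$ with $N$ the order of that graph). The graph energy $\mathcal E(G)$ is the sum of the absolute values of the adjacency eigenvalues counted with multiplicity. The energy-gap factor of a graph with $s_G>0$ is $\kappa(G)=\operatorname{FR}_{\min}(G)\big/\bigl(\mathcal E(G)/\sqrt{2s_G}\bigr)$. *)

theory Defs
  imports
    "Jordan_Normal_Form.Spectral_Radius"
    "Graph_Theory.Pair_Digraph"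
begin

text \<open>
  A finite simple undirected graph is a \<^locale>\<open>pair_graph\<close>: a finite vertex set together with
  a symmetric, irreflexive set of ordered pairs on it, so every edge contributes two arcs.
\<close>

definition num_edges :: "'a pair_pre_digraph \<Rightarrow> nat" where
  "num_edges G = card {{u, v} |u v. (u, v) \<in> parcs G}"

definition weak_product ::
  "'a pair_pre_digraph \<Rightarrow> 'b pair_pre_digraph \<Rightarrow> ('a \<times> 'b) pair_pre_digraph" where
  "weak_product G H =
    \<lparr>pverts = pverts G \<times> pverts H,
     parcs = {((g1, h1), (g2, h2)) |g1 h1 g2 h2.
       (g1, g2) \<in> parcs G \<and> (h1, h2) \<in> parcs H}\<rparr>"

definition cartesian_product ::
  "'a pair_pre_digraph \<Rightarrow> 'b pair_pre_digraph \<Rightarrow> ('a \<times> 'b) pair_pre_digraph" where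
  "cartesian_product G H =
    \<lparr>pverts = pverts G \<times> pverts H,
     parcs = {((g1, h1), (g2, h2)) |g1 h1 g2 h2.
       g1 \<in> pverts G \<and> g2 \<in> pverts G \<and> h1 \<in> pverts H \<and> h2 \<in> pverts H \<and>
       (g1 = g2 \<and> (h1, h2) \<in> parcs H \<or> h1 = h2 \<and> (g1, g2) \<in> parcs G)}\<rparr>"

definition strong_product ::
  "'a pair_pre_digraph \<Rightarrow> 'b pair_pre_digraph \<Rightarrow> ('a \<times> 'b) pair_pre_digraph" where
  "strong_product G H =
    \<lparr>pverts = pverts G \<times> pverts H,
     parcs = parcs (weak_product G H) \<union> parcs (cartesian_product G H)\<rparr>"

lemma pair_graph_strong_product:
  assumes "pair_graph G" "pair_graph H"
  shows "pair_graph (strong_product G H)"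
proof -
  interpret G: pair_graph G by fact
  interpret H: pair_graph H by fact
  have fin: "finite (pverts (strong_product G H))"
    by (simp add: strong_product_def G.pair_finite_verts H.pair_finite_verts)
  have sub: "parcs (strong_product G H) \<subseteq>
      pverts (strong_product G H) \<times> pverts (strong_product G H)"
    by (auto simp: strong_product_def weak_product_def cartesian_product_def
        dest: G.in_arcsD1 G.in_arcsD2 H.in_arcsD1 H.in_arcsD2)
  have symG: "(v, u) \<in> parcs G" if "(u, v) \<in> parcs G" for u v
    using G.pair_sym_arcs that by (auto simp: symmetric_def dest: symD)
  have symH: "(v, u) \<in> parcs H" if "(u, v) \<in> parcs H" for u v
    using H.pair_sym_arcs that by (auto simp: symmetric_def dest: symD)
  show ?thesis
  proof
    fix e assume e: "e \<in> parcs (strong_product G H)"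
    show "fst e \<in> pverts (strong_product G H)" "snd e \<in> pverts (strong_product G H)"
      using sub e by auto
    show "fst e \<noteq> snd e"
      using e by (auto simp: strong_product_def weak_product_def cartesian_product_def
          dest: G.pair_no_loops H.pair_no_loops)
  next
    show "finite (parcs (strong_product G H))"
      using fin sub by (meson finite_SigmaI finite_subset)
    show "symmetric (with_proj (strong_product G H))"
      by (auto simp: symmetric_def strong_product_def weak_product_def cartesian_product_def
          intro!: symI dest: symG symH)
  qed (rule fin)
qed

text \<open>
  Residues modulo \<open>N\<close> are represented by \<open>{..<N}\<close>, which is also the index range of an
  \<open>N \<times> N\<close> matrix of type \<^typ>\<open>complex mat\<close>. Labelings are extensional, i.e. have a fixed dummy
  value outside the vertex set, so that a finite graph has only finitely many of them.
\<close>

definition labelings :: "'a pair_pre_digraph \<Rightarrow> ('a \<Rightarrow> nat) set" where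
  "labelings G = {\<sigma> \<in> extensional (pverts G). bij_betw \<sigma> (pverts G) {..<card (pverts G)}}"

definition adj_matrix :: "'a pair_pre_digraph \<Rightarrow> ('a \<Rightarrow> nat) \<Rightarrow> complex mat" where
  "adj_matrix G \<sigma> = mat (card (pverts G)) (card (pverts G))
     (\<lambda>(x, y). if (inv_into (pverts G) \<sigma> x, inv_into (pverts G) \<sigma> y) \<in> parcs G then 1 else 0)"

lemma finite_labelings:
  assumes "finite (pverts G)"
  shows "finite (labelings G)"
proof (rule finite_subset)
  show "labelings G \<subseteq> pverts G \<rightarrow>\<^sub>E {..<card (pverts G)}"
    by (auto simp: labelings_def PiE_def bij_betw_def)
  show "finite (pverts G \<rightarrow>\<^sub>E {..<card (pverts G)})"
    using assms by (intro finite_PiE) auto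
qed

lemma labelings_nonempty:
  assumes "finite (pverts G)"
  shows "labelings G \<noteq> {}"
proof -
  obtain f where "bij_betw f (pverts G) {..<card (pverts G)}"
    using ex_bij_betw_finite_nat[OF assms] unfolding atLeast0LessThan by blast
  then have "bij_betw (restrict f (pverts G)) (pverts G) {..<card (pverts G)}"
    by (subst bij_betw_cong[where g = f]) auto
  then show ?thesis
    unfolding labelings_def by (metis (mono_tags, lifting) empty_iff mem_Collect_eq restrict_extensional)
qed

definition fourier_matrix :: "nat \<Rightarrow> complex mat" where
  "fourier_matrix N = mat N N
     (\<lambda>(m, x). exp (- 2 * of_real pi * \<i> * of_nat m * of_nat x / of_nat N) / of_real (sqrt (real N)))"

definition entrywise_l1_norm :: "complex mat \<Rightarrow> real" where
  "entrywise_l1_norm M = (\<Sum>x<dim_row M. \<Sum>y<dim_col M. cmod (M $$ (x, y)))"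

definition frobenius_norm :: "complex mat \<Rightarrow> real" where
  "frobenius_norm M = sqrt (\<Sum>x<dim_row M. \<Sum>y<dim_col M. (cmod (M $$ (x, y)))\<^sup>2)"

definition fourier_ratio :: "complex mat \<Rightarrow> real" where
  "fourier_ratio M =
    (let F = fourier_matrix (dim_row M); T = F * M * F
     in entrywise_l1_norm T / frobenius_norm T)"

definition edge_complexity :: "'a pair_pre_digraph \<Rightarrow> real" where
  "edge_complexity G = Min ((\<lambda>\<sigma>. fourier_ratio (adj_matrix G \<sigma>)) ` labelings G)"

text \<open>The multiplicity of an eigenvalue is its order as a root of the characteristic polynomial.\<close>

definition matrix_energy :: "complex mat \<Rightarrow> real" where
  "matrix_energy A = (\<Sum>ev\<in>spectrum A. real (order ev (char_poly A)) * cmod ev)"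

text \<open>
  The energy is read off from the adjacency matrix under an arbitrarily chosen labeling; by
  \<open>graph_energy_eq\<close> below it does not depend on the choice.
\<close>

definition graph_energy :: "'a pair_pre_digraph \<Rightarrow> real" where
  "graph_energy G = matrix_energy (adj_matrix G (SOME \<sigma>. \<sigma> \<in> labelings G))"

lemma similar_adj_matrix:
  assumes "\<sigma> \<in> labelings G" "\<tau> \<in> labelings G"
  shows "similar_mat (adj_matrix G \<sigma>) (adj_matrix G \<tau>)"
proof -
  define V n where "V = pverts G" and "n = card V"
  have s: "bij_betw \<sigma> V {..<n}" and t: "bij_betw \<tau> V {..<n}"
    using assms by (auto simp: labelings_def V_def n_def)
  define p where "p = (\<lambda>x. \<sigma> (inv_into V \<tau> x))"
  define q where "q = (\<lambda>x. \<tau> (inv_into V \<sigma> x))"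
  define P where "P = mat n n (\<lambda>(x, y). if x = p y then 1 else 0 :: complex)"
  define Q where "Q = mat n n (\<lambda>(x, y). if x = q y then 1 else 0 :: complex)"
  have si: "inv_into V \<sigma> x \<in> V" "\<sigma> (inv_into V \<sigma> x) = x"
    and ti: "inv_into V \<tau> x \<in> V" "\<tau> (inv_into V \<tau> x) = x" if "x < n" for x
    using s t that by (auto simp: bij_betw_def inv_into_into f_inv_into_f)
  have iv: "inv_into V \<sigma> (\<sigma> v) = v" "inv_into V \<tau> (\<tau> v) = v" "\<sigma> v < n" "\<tau> v < n" if "v \<in> V" for v
    using s t that by (auto simp: bij_betw_def)
  have pq: "p x < n" "q x < n" "p (q x) = x" "q (p x) = x" if "x < n" for x
    using that by (auto simp: p_def q_def si ti iv)
  have A: "adj_matrix G \<sigma> \<in> carrier_mat n n" "adj_matrix G \<tau> \<in> carrier_mat n n"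
    by (auto simp: adj_matrix_def n_def V_def)
  have PQ: "P \<in> carrier_mat n n" "Q \<in> carrier_mat n n"
    by (auto simp: P_def Q_def)
  have "P * Q = 1\<^sub>m n"
    by (rule eq_matI) (auto simp: P_def Q_def scalar_prod_def pq if_distrib sum.If_cases
        cong: if_cong)
  moreover have "Q * P = 1\<^sub>m n"
    by (rule eq_matI) (auto simp: P_def Q_def scalar_prod_def pq if_distrib sum.If_cases
        cong: if_cong)
  moreover have "adj_matrix G \<sigma> = P * adj_matrix G \<tau> * Q"
  proof -
    have "P * adj_matrix G \<tau> = mat n n (\<lambda>(x, y). adj_matrix G \<tau> $$ (q x, y))"
    proof (rule eq_matI)
      fix i j assume "i < dim_row (mat n n (\<lambda>(x, y). adj_matrix G \<tau> $$ (q x, y)))"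
        "j < dim_col (mat n n (\<lambda>(x, y). adj_matrix G \<tau> $$ (q x, y)))"
      then have ij: "i < n" "j < n" by auto
      have eq: "i = p k \<longleftrightarrow> k = q i" if "k < n" for k
        using pq that ij by metis
      have "(P * adj_matrix G \<tau>) $$ (i, j) =
          (\<Sum>k = 0..<n. (if k = q i then adj_matrix G \<tau> $$ (k, j) else 0))"
        using ij A PQ by (auto simp: scalar_prod_def P_def eq if_distrib[of "\<lambda>c. c * _"] cong: if_cong)
      then show "(P * adj_matrix G \<tau>) $$ (i, j) =
          mat n n (\<lambda>(x, y). adj_matrix G \<tau> $$ (q x, y)) $$ (i, j)"
        using ij pq by simp
    qed (use A PQ in auto)
    moreover have "mat n n (\<lambda>(x, y). adj_matrix G \<tau> $$ (q x, y)) * Q = adj_matrix G \<sigma>"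
    proof (rule eq_matI)
      fix i j assume "i < dim_row (adj_matrix G \<sigma>)" "j < dim_col (adj_matrix G \<sigma>)"
      then have ij: "i < n" "j < n" using A by auto
      have "(mat n n (\<lambda>(x, y). adj_matrix G \<tau> $$ (q x, y)) * Q) $$ (i, j) =
          (\<Sum>k = 0..<n. (if k = q j then adj_matrix G \<tau> $$ (q i, k) else 0))"
        using ij by (auto simp: scalar_prod_def Q_def if_distrib[of "\<lambda>c. _ * c"] cong: if_cong)
      also have "\<dots> = adj_matrix G \<tau> $$ (q i, q j)"
        using ij pq by simp
      also have "\<dots> = adj_matrix G \<sigma> $$ (i, j)"
        using ij pq si iv
        by (simp add: adj_matrix_def flip: V_def n_def) (simp add: q_def si iv)
      finally show "(mat n n (\<lambda>(x, y). adj_matrix G \<tau> $$ (q x, y)) * Q) $$ (i, j) =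
        adj_matrix G \<sigma> $$ (i, j)" .
    qed (use A PQ in auto)
    ultimately show ?thesis by simp
  qed
  ultimately show ?thesis
    using A PQ by (intro similar_matI[of _ _ P Q n]) auto
qed

lemma graph_energy_eq:
  assumes "\<sigma> \<in> labelings G"
  shows "graph_energy G = matrix_energy (adj_matrix G \<sigma>)"
proof -
  define \<tau> where "\<tau> = (SOME \<sigma>. \<sigma> \<in> labelings G)"
  have "\<tau> \<in> labelings G" unfolding \<tau>_def using someI[of "\<lambda>\<sigma>. \<sigma> \<in> labelings G"] assms by blast
  then have "char_poly (adj_matrix G \<tau>) = char_poly (adj_matrix G \<sigma>)"
    using assms by (intro char_poly_similar similar_adj_matrix)
  moreover have "spectrum (adj_matrix G \<rho>) = {ev. poly (char_poly (adj_matrix G \<rho>)) ev = 0}" for \<rho>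
    using eigenvalue_root_char_poly[of "adj_matrix G \<rho>" "card (pverts G)"]
    by (auto simp: spectrum_def adj_matrix_def)
  ultimately show ?thesis
    unfolding graph_energy_def matrix_energy_def \<tau>_def[symmetric]
    by simp
qed

definition energy_gap_factor :: "'a pair_pre_digraph \<Rightarrow> real" where
  "energy_gap_factor G =
    edge_complexity G / (graph_energy G / sqrt (2 * real (num_edges G)))"

definition order_energy_ratio :: "'a pair_pre_digraph \<Rightarrow> 'b pair_pre_digraph \<Rightarrow> real" where
  "order_energy_ratio G H =
    real (card (pverts G)) / graph_energy G + real (card (pverts H)) / graph_energy H"

end

theory Submission
  imports Defs
    "Jordan_Normal_Form.Jordan_Normal_Form_Uniqueness"
    "HOL-Number_Theory.Cong"
begin

text \<open>
  With \<open>A\<close> and \<open>B\<close> the adjacency matrices of \<open>G\<close> and \<open>H\<close>, the strong product has the adjacency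
  matrix \<open>(A + I) \<otimes> (B + I) - I\<close>, whose eigenvalues are \<open>\<lambda>\<mu> + \<lambda> + \<mu>\<close> for eigenvalues
  \<open>\<lambda>\<close> of \<open>A\<close> and \<open>\<mu>\<close> of \<open>B\<close>; the triangle inequality gives the energy bound.

  For coprime orders the labeling \<open>(a, b) \<mapsto> n\<^sub>2 a + n\<^sub>1 b\<close> modulo \<open>n\<^sub>1 n\<^sub>2\<close> makes the Fourier matrix a
  tensor product, so that the transforms of \<open>A \<otimes> B\<close>, \<open>A \<otimes> I\<close> and \<open>I \<otimes> B\<close> factor. Since
  \<open>F I F = F\<^sup>2\<close> is a permutation matrix, the transform of the strong product has \<open>\<ell>\<^sub>1\<close> norm at most
  \<open>a b + a n\<^sub>2 + n\<^sub>1 b\<close> with \<open>a\<close>, \<open>b\<close> the \<open>\<ell>\<^sub>1\<close> norms of the transforms of \<open>A\<close> and \<open>B\<close>. These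
  dominate the energies by a unitary Schur decomposition, and the Frobenius norms cancel.
\<close>

section \<open>Unitary matrices and Schur decomposition\<close>

text \<open>For square matrices the reverse identity follows; \<open>unitary_matD\<close> delivers
  both.\<close>

definition unitary_mat :: "nat \<Rightarrow> complex mat \<Rightarrow> bool" where
  "unitary_mat n U \<longleftrightarrow> U \<in> carrier_mat n n \<and> mat_adjoint U * U = 1\<^sub>m n"

lemma dim_mat_adjoint [simp]:
  "dim_row (mat_adjoint A) = dim_col A" "dim_col (mat_adjoint A) = dim_row A"
  by (simp_all add: mat_adjoint_def)

lemma mat_adjoint_carrier [simp]:
  "mat_adjoint A \<in> carrier_mat m n \<longleftrightarrow> A \<in> carrier_mat n m"
  by (auto simp only: carrier_mat_def mem_Collect_eq dim_mat_adjoint)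

lemma index_mat_adjoint [simp]:
  fixes A :: "complex mat"
  assumes "i < dim_col A" "j < dim_row A"
  shows "mat_adjoint A $$ (i, j) = cnj (A $$ (j, i))"
  using assms by (auto simp: mat_adjoint_def mat_of_rows_def)

lemma mat_adjoint_adjoint [simp]: "mat_adjoint (mat_adjoint A) = (A :: complex mat)"
  by (rule eq_matI) auto

lemma mat_adjoint_mult:
  fixes A B :: "complex mat"
  assumes "A \<in> carrier_mat m n" "B \<in> carrier_mat n k"
  shows "mat_adjoint (A * B) = mat_adjoint B * mat_adjoint A"
  using assms by (intro eq_matI) (auto simp: scalar_prod_def intro!: sum.cong)

lemma unitary_matD:
  assumes "unitary_mat n U"
  shows "U \<in> carrier_mat n n" "mat_adjoint U \<in> carrier_mat n n"
    "mat_adjoint U * U = 1\<^sub>m n" "U * mat_adjoint U = 1\<^sub>m n"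
  using assms mat_mult_left_right_inverse[of "mat_adjoint U" n U] by (auto simp: unitary_mat_def)

lemma unitary_mat_one: "unitary_mat n (1\<^sub>m n)"
proof -
  have "mat_adjoint (1\<^sub>m n) = (1\<^sub>m n :: complex mat)"
    by (rule eq_matI) auto
  then show ?thesis by (simp add: unitary_mat_def)
qed

lemma unitary_mat_adjoint:
  assumes "unitary_mat n U"
  shows "unitary_mat n (mat_adjoint U)"
  using unitary_matD(2,4)[OF assms] by (simp add: unitary_mat_def)

lemma unitary_mat_mult:
  assumes U: "unitary_mat n U" and V: "unitary_mat n V"
  shows "unitary_mat n (U * V)"
proof -
  note u = unitary_matD[OF U] and v = unitary_matD[OF V]
  have "mat_adjoint (U * V) * (U * V) = mat_adjoint V * (mat_adjoint U * (U * V))"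
    unfolding mat_adjoint_mult[OF u(1) v(1)] using u(1,2) v(1,2)
    by (intro assoc_mult_mat) auto
  also have "mat_adjoint U * (U * V) = mat_adjoint U * U * V"
    using u(1,2) v(1) by (intro assoc_mult_mat[symmetric]) auto
  also have "\<dots> = V"
    using v(1) by (simp add: u(3))
  finally have "mat_adjoint (U * V) * (U * V) = 1\<^sub>m n"
    using v(3) by simp
  then show ?thesis
    unfolding unitary_mat_def using mult_carrier_mat[OF u(1) v(1)] by simp
qed

text \<open>Bordering by a leading 1 lifts the unitary matrix obtained for the lower right block in
  the Schur induction to the full size.\<close>

lemma unitary_mat_four_block_one:
  assumes "unitary_mat n U"
  shows "unitary_mat (Suc n) (four_block_mat (1\<^sub>m 1) (0\<^sub>m 1 n) (0\<^sub>m n 1) U)"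
    "mat_adjoint (four_block_mat (1\<^sub>m 1) (0\<^sub>m 1 n) (0\<^sub>m n 1) U) =
      four_block_mat (1\<^sub>m 1) (0\<^sub>m 1 n) (0\<^sub>m n 1) (mat_adjoint U)"
proof -
  note u = unitary_matD[OF assms]
  show eq: "mat_adjoint (four_block_mat (1\<^sub>m 1) (0\<^sub>m 1 n) (0\<^sub>m n 1) U) =
      four_block_mat (1\<^sub>m 1) (0\<^sub>m 1 n) (0\<^sub>m n 1) (mat_adjoint U)"
    using u by (intro eq_matI) (auto simp: four_block_mat_def Let_def)
  have "four_block_mat (1\<^sub>m 1) (0\<^sub>m 1 n) (0\<^sub>m n 1) (mat_adjoint U) *
      four_block_mat (1\<^sub>m 1) (0\<^sub>m 1 n) (0\<^sub>m n 1) U = 1\<^sub>m (Suc n)"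
    using u by (subst mult_four_block_mat[of _ 1 1 _ n _ n _ _ 1 _ n]) auto
  then show "unitary_mat (Suc n) (four_block_mat (1\<^sub>m 1) (0\<^sub>m 1 n) (0\<^sub>m n 1) U)"
    unfolding unitary_mat_def eq using u by auto
qed

lemma cscalar_prod_self:
  fixes w :: "complex vec"
  shows "w \<bullet>c w = complex_of_real (\<Sum>i<dim_vec w. (cmod (w $ i))\<^sup>2)"
  by (simp add: scalar_prod_def lessThan_atLeast0 complex_norm_square del: of_real_power)

lemma normalize_vec:
  fixes w :: "complex vec"
  assumes "w \<in> carrier_vec n" "w \<noteq> 0\<^sub>v n"
  obtains c where "c \<noteq> 0" "(c \<cdot>\<^sub>v w) \<bullet>c (c \<cdot>\<^sub>v w) = 1"
proof -
  define s where "s = (\<Sum>i<dim_vec w. (cmod (w $ i))\<^sup>2)"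
  have ww: "w \<bullet>c w = complex_of_real s"
    unfolding s_def by (rule cscalar_prod_self)
  have "s \<noteq> 0"
    using conjugate_square_eq_0_vec[OF assms(1)] assms(2) ww by auto
  moreover have "s \<ge> 0" unfolding s_def by (intro sum_nonneg) auto
  ultimately have s: "s > 0" by simp
  define c where "c = complex_of_real (1 / sqrt s)"
  have "(c \<cdot>\<^sub>v w) \<bullet>c (c \<cdot>\<^sub>v w) = c * cnj c * (w \<bullet>c w)"
    using assms(1) by (simp add: scalar_prod_def sum_distrib_left mult_ac)
  also have "\<dots> = complex_of_real ((1 / sqrt s) * (1 / sqrt s) * s)"
    unfolding ww c_def complex_cnj_complex_of_real of_real_mult by (rule refl)
  also have "(1 / sqrt s) * (1 / sqrt s) * s = 1"
  proof -
    have "(1 / sqrt s) * (1 / sqrt s) * s = s / (sqrt s * sqrt s)" by simp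
    then show ?thesis using s by simp
  qed
  finally show thesis
    using s by (intro that[of c]) (auto simp: c_def)
qed

text \<open>The eigenvector is completed to a basis, orthogonalised by Gram-Schmidt and normalised.
  The first column of \<open>W\<close> is then a multiple of \<open>v\<close>, so conjugation by
  \<open>W\<close> sends the first unit vector to \<open>e\<close> times itself.\<close>

lemma unitary_mat_with_eigenvector:
  fixes A :: "complex mat"
  assumes A: "A \<in> carrier_mat n n" and ev: "eigenvector A v e"
  obtains W where "unitary_mat n W"
    "col (mat_adjoint W * A * W) 0 = vec n (\<lambda>i. if i = 0 then e else 0)"
proof -
  from ev A have v: "v \<in> carrier_vec n" and v0: "v \<noteq> 0\<^sub>v n" and eig: "A *\<^sub>v v = e \<cdot>\<^sub>v v"
    by (auto simp: eigenvector_def)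
  have n: "n \<noteq> 0" using v v0 by (auto intro: eq_vecI)
  interpret cof_vec_space n "TYPE(complex)" .
  note bc = basis_completion[OF v v0]
  define ws where "ws = gram_schmidt n (basis_completion v)"
  note gs = gram_schmidt_result[OF bc(2) bc(4) bc(5) ws_def]
  have lws: "length ws = n" using gs(4) bc(6) by simp
  have hdws: "hd ws = v"
    using bc(6,7) n v unfolding ws_def by (cases "basis_completion v") auto
  have wsi: "ws ! i \<in> carrier_vec n" if "i < n" for i using gs(3) lws that by auto
  have orth: "ws ! i \<bullet>c ws ! j = 0 \<longleftrightarrow> i \<noteq> j" if "i < n" "j < n" for i j
    using corthogonalD[OF gs(2)] that lws by auto
  have "\<exists>c. c \<noteq> 0 \<and> (c \<cdot>\<^sub>v ws ! i) \<bullet>c (c \<cdot>\<^sub>v ws ! i) = 1" if "i < n" for i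
  proof -
    have "ws ! i \<noteq> 0\<^sub>v n"
      using orth[OF that that] conjugate_square_eq_0_vec[OF wsi[OF that]] by auto
    then show ?thesis using normalize_vec[OF wsi[OF that]] by metis
  qed
  then obtain c where c: "\<And>i. i < n \<Longrightarrow> c i \<noteq> 0"
    "\<And>i. i < n \<Longrightarrow> (c i \<cdot>\<^sub>v ws ! i) \<bullet>c (c i \<cdot>\<^sub>v ws ! i) = 1"
    by metis
  define us where "us = map (\<lambda>i. c i \<cdot>\<^sub>v ws ! i) [0..<n]"
  have lus: "length us = n" by (simp add: us_def)
  have usi: "us ! i = c i \<cdot>\<^sub>v ws ! i" if "i < n" for i using that by (simp add: us_def)
  have usc: "set us \<subseteq> carrier_vec n" using wsi by (auto simp: us_def)
  have prod: "us ! i \<bullet>c us ! j = c i * cnj (c j) * (ws ! i \<bullet>c ws ! j)" if "i < n" "j < n" for i j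
    using that wsi[of i] wsi[of j]
    by (simp add: usi scalar_prod_def sum_distrib_left mult_ac)
  have cor: "corthogonal us"
    by (rule corthogonalI) (use lus prod orth c in auto)
  have "v = ws ! 0" "hd us = us ! 0"
    using n hdws lws lus hd_conv_nth[of ws] hd_conv_nth[of us] by fastforce+
  then have hdus: "hd us = c 0 \<cdot>\<^sub>v v" using n usi by simp
  define W where "W = mat_of_cols n us"
  have W: "W \<in> carrier_mat n n" using lus by (auto simp: W_def)
  have cols: "cols W = us" unfolding W_def using usc by (rule cols_mat_of_cols)
  \<comment> \<open>In general \<open>vec_inv u\<close> is \<open>conjugate u\<close> divided by the
    squared norm of \<open>u\<close>. Normalisation removes this factor, which turns
    \<open>corthogonal_inv\<close> into the adjoint.\<close>
  have "vec_inv u = conjugate u" if u: "u \<in> set us" for u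
  proof -
    obtain i where i: "i < n" "u = us ! i" using u lus unfolding in_set_conv_nth by auto
    have "u \<bullet>c u = 1" unfolding i(2) usi[OF i(1)] by (rule c(2)[OF i(1)])
    then show ?thesis by (simp add: vec_inv_def)
  qed
  then have inv: "corthogonal_inv W = mat_adjoint W"
    unfolding corthogonal_inv_def mat_adjoint_def cols by (metis (mono_tags, lifting) map_eq_conv)
  have "corthogonal_mat W"
    unfolding W_def using usc cor lus by (rule orthogonal_mat_of_cols)
  from corthogonal_inv_result[OF this] have unit: "unitary_mat n W"
    using W by (simp add: inv unitary_mat_def inverts_mat_def)
  have eig': "A *\<^sub>v (c 0 \<cdot>\<^sub>v v) = e \<cdot>\<^sub>v (c 0 \<cdot>\<^sub>v v)"
    unfolding mult_mat_vec[OF A v] eig smult_smult_assoc by (simp add: mult.commute)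
  have nz: "c 0 \<cdot>\<^sub>v v \<noteq> 0\<^sub>v n"
  proof
    assume z: "c 0 \<cdot>\<^sub>v v = 0\<^sub>v n"
    have "v = 0\<^sub>v n"
    proof (rule eq_vecI)
      fix i assume "i < dim_vec (0\<^sub>v n :: complex vec)"
      then show "v $ i = 0\<^sub>v n $ i"
        using arg_cong[OF z, of "\<lambda>w. w $ i"] c(1)[of 0] n v by auto
    qed (use v in auto)
    then show False using v0 by simp
  qed
  have "col (mat_adjoint W * A * W) 0 = vec n (\<lambda>i. if i = 0 then e else 0)"
    using corthogonal_col_ev_0[OF A smult_carrier_vec[THEN iffD2, OF v] nz eig' n hdus usc cor lus]
    unfolding W_def[symmetric] inv .
  with unit show thesis by (rule that)
qed

text \<open>Induction by deflation: an eigenvector clears the first column below the diagonal, and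
  the hypothesis triangularises the remaining block. Unitarity of the conjugating matrix matters
  later, because the comparison of energy and entrywise norm relies on its rows being unit
  vectors.\<close>

theorem unitary_schur:
  fixes A :: "complex mat"
  assumes "A \<in> carrier_mat n n"
  shows "\<exists>U B. unitary_mat n U \<and> upper_triangular B \<and> similar_mat_wit A B U (mat_adjoint U)"
  using assms
proof (induction n arbitrary: A)
  case 0
  have "mat_adjoint (1\<^sub>m 0) = (1\<^sub>m 0 :: complex mat)" by (rule eq_matI) auto
  then show ?case
    using 0 similar_mat_wit_refl[OF 0] unitary_mat_one[of 0]
    by (intro exI[of _ "1\<^sub>m 0"] exI[of _ A]) auto
next
  case (Suc n)
  note A = Suc.prems
  obtain es where es: "char_poly A = (\<Prod>a\<leftarrow>es. [:- a, 1:])" "length es = Suc n"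
    using char_poly_factorized[OF A] by auto
  then obtain e es' where "es = e # es'" by (cases es) auto
  then have "eigenvalue A e" using es by (simp add: eigenvalue_root_char_poly[OF A])
  then obtain v where "eigenvector A v e" by (auto simp: eigenvalue_def)
  then obtain W where W: "unitary_mat (Suc n) W"
    and col0: "col (mat_adjoint W * A * W) 0 = vec (Suc n) (\<lambda>i. if i = 0 then e else 0)"
    using unitary_mat_with_eigenvector[OF A] by metis
  note w = unitary_matD[OF W]
  define A' where "A' = mat_adjoint W * A * W"
  have A': "A' \<in> carrier_mat (Suc n) (Suc n)" using A w by (simp add: A'_def)
  have "similar_mat_wit A' A (mat_adjoint W) W"
    by (rule similar_mat_witI[of _ _ "Suc n"]) (use A w A' in \<open>auto simp: A'_def\<close>)
  then have simAA': "similar_mat_wit A A' W (mat_adjoint W)" by (rule similar_mat_wit_sym)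
  obtain A1 A2 A0 A3 where split: "split_block A' 1 1 = (A1, A2, A0, A3)"
    by (cases "split_block A' 1 1") auto
  have "dim_row A' = 1 + n" "dim_col A' = 1 + n" using A' by auto
  from split_block[OF split this] have A1: "A1 \<in> carrier_mat 1 1" and A2: "A2 \<in> carrier_mat 1 n"
    and A0: "A0 \<in> carrier_mat n 1" and A3: "A3 \<in> carrier_mat n n"
    and A'block: "A' = four_block_mat A1 A2 A0 A3" by auto
  have "A' $$ (Suc i, 0) = 0" if "i < n" for i
    using arg_cong[OF col0, of "\<lambda>v. v $ Suc i"] that A' by (simp add: A'_def[symmetric])
  then have A0id: "A0 = 0\<^sub>m n 1"
    using split[unfolded split_block_def Let_def] A' by auto
  obtain U B where U: "unitary_mat n U" and ut: "upper_triangular B"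
    and sim: "similar_mat_wit A3 B U (mat_adjoint U)"
    using Suc.IH[OF A3] by auto
  note u = unitary_matD[OF U]
  have B: "B \<in> carrier_mat n n" using similar_mat_witD2[OF A3 sim] by auto
  \<comment> \<open>Conjugating \<open>A'\<close> by \<open>P\<close> replaces the lower right block
    by its triangular form \<open>B\<close> and multiplies the rest of the first row by
    \<open>U\<close>; the zero block \<open>A0\<close> is unaffected. This gives
    \<open>C\<close>.\<close>
  define P where "P = four_block_mat (1\<^sub>m 1) (0\<^sub>m 1 n) (0\<^sub>m n 1) U"
  define C where "C = four_block_mat A1 (A2 * U) A0 B"
  note P = unitary_mat_four_block_one[OF U, folded P_def]
  have "A0 = U * A0 * 1\<^sub>m 1" unfolding A0id using u by auto
  moreover have "A2 = 1\<^sub>m 1 * (A2 * U) * mat_adjoint U"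
    using A2 u by (simp add: assoc_mult_mat[of _ 1 n _ n _ n])
  ultimately have "similar_mat_wit A' C P (mat_adjoint P)"
    unfolding A'block C_def P(2) unfolding P_def
    using similar_mat_wit_four_block[OF similar_mat_wit_refl[OF A1] sim _ _ A1 A3 A0, of A2 "A2 * U"]
      A2 u by auto
  from similar_mat_wit_trans[OF simAA' this]
  have "similar_mat_wit A C (W * P) (mat_adjoint (W * P))"
    using mat_adjoint_mult[OF w(1) unitary_matD(1)[OF P(1)]] by simp
  moreover have "upper_triangular C"
    unfolding C_def A0id using A1 B ut
    by (intro upper_triangular_four_block[of _ 1]) (auto simp: upper_triangular_def)
  ultimately show ?case using unitary_mat_mult[OF W P(1)] by blast
qed

section \<open>Energy, entrywise norm and Frobenius norm\<close>

text \<open>Orders add over products, and a linear factor contributes 1 exactly at its root.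
  Algebraic multiplicities thus become numbers of occurrences on a triangular diagonal.\<close>

lemma order_prod_list_linear:
  "Polynomial.order x (\<Prod>a\<leftarrow>es. [:- a, 1:]) = count_list es (x :: complex)"
proof (induction es)
  case (Cons a es)
  have nz: "(\<Prod>a\<leftarrow>es. [:- a, 1:]) \<noteq> 0"
    by (auto simp: prod_list_zero_iff)
  have "Polynomial.order x [:- a, 1:] = (if a = x then 1 else 0)"
    by (auto simp: order_linear')
  then show ?case
    using Cons nz by (simp add: order_mult del: mult_pCons_left)
qed (simp add: order_0I)

lemma sum_count_list:
  fixes f :: "'a \<Rightarrow> real"
  assumes "finite S" "set xs \<subseteq> S"
  shows "(\<Sum>x\<in>S. real (count_list xs x) * f x) = sum_list (map f xs)"
  using assms(2)
proof (induction xs)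
  case (Cons a xs)
  have "(\<Sum>x\<in>S. real (count_list (a # xs) x) * f x) =
      (\<Sum>x\<in>S. (if x = a then f x else 0) + real (count_list xs x) * f x)"
    by (intro sum.cong) (auto simp: algebra_simps)
  also have "\<dots> = f a + sum_list (map f xs)"
    using Cons assms(1) by (simp add: sum.distrib)
  finally show ?case by simp
qed simp

text \<open>The diagonal of \<open>B\<close> lists the roots of the common characteristic polynomial
  with multiplicity, so the weighted sum over the spectrum is a plain sum over diagonal
  positions.\<close>

lemma matrix_energy_similar_upper_triangular:
  assumes A: "A \<in> carrier_mat n n" and sim: "similar_mat A B" and ut: "upper_triangular B"
  shows "matrix_energy A = (\<Sum>i<n. cmod (B $$ (i, i)))"
proof -
  from sim obtain P Q where "similar_mat_wit A B P Q" by (auto simp: similar_mat_def)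
  then have B: "B \<in> carrier_mat n n" using similar_mat_witD2[OF A] by auto
  define es where "es = diag_mat B"
  have cp: "char_poly A = (\<Prod>a\<leftarrow>es. [:- a, 1:])"
    unfolding es_def char_poly_similar[OF sim] by (rule char_poly_upper_triangular[OF B ut])
  have "spectrum A = set es"
    unfolding spectrum_def eigenvalue_root_char_poly[OF A] cp
    by (auto simp: poly_prod_list prod_list_zero_iff)
  then have "matrix_energy A = (\<Sum>ev\<in>set es. real (count_list es ev) * cmod ev)"
    by (simp add: matrix_energy_def cp order_prod_list_linear)
  also have "\<dots> = sum_list (map cmod es)"
    by (rule sum_count_list) auto
  also have "\<dots> = (\<Sum>i<n. cmod (B $$ (i, i)))"
    using B by (simp add: es_def diag_mat_def sum_list_sum_nth lessThan_atLeast0)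
  finally show ?thesis .
qed

lemma matrix_energy_nonneg: "matrix_energy A \<ge> 0"
  unfolding matrix_energy_def by (intro sum_nonneg) auto

lemma index_mult_mat3:
  fixes A B C :: "complex mat"
  assumes "A \<in> carrier_mat n n" "B \<in> carrier_mat n n" "C \<in> carrier_mat n n" "i < n" "j < n"
  shows "(A * B * C) $$ (i, j) = (\<Sum>a<n. \<Sum>b<n. A $$ (i, a) * B $$ (a, b) * C $$ (b, j))"
proof -
  have "(A * B * C) $$ (i, j) = (\<Sum>a<n. A $$ (i, a) * (\<Sum>b<n. B $$ (a, b) * C $$ (b, j)))"
    using assms by (simp add: scalar_prod_def lessThan_atLeast0)
  then show ?thesis by (simp add: sum_distrib_left mult.assoc)
qed

lemma unitary_mat_row_norm:
  assumes U: "unitary_mat n U" and a: "a < n"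
  shows "(\<Sum>i<n. (cmod (U $$ (a, i)))\<^sup>2) = 1"
proof -
  note u = unitary_matD[OF U]
  have "complex_of_real (\<Sum>i<n. (cmod (U $$ (a, i)))\<^sup>2) = (\<Sum>i<n. U $$ (a, i) * cnj (U $$ (a, i)))"
    by (simp add: complex_norm_square del: of_real_power)
  also have "\<dots> = (U * mat_adjoint U) $$ (a, a)"
    using u(1) a by (simp add: scalar_prod_def lessThan_atLeast0)
  also have "\<dots> = complex_of_real 1"
    using a by (simp add: u(4))
  finally show ?thesis by (simp only: of_real_eq_iff)
qed

text \<open>After expanding and exchanging sums, \<open>cmod (T $$ (a, b))\<close> carries as weight
  the sum over \<open>i\<close> of \<open>cmod (X $$ (a, i)) * cmod (Y $$ (b, i))\<close>. This is
  at most 1 because rows of unitary matrices are unit vectors.\<close>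

lemma sum_cmod_diagonal_le_l1_norm:
  assumes X: "unitary_mat n X" and Y: "unitary_mat n Y" and T: "T \<in> carrier_mat n n"
  shows "(\<Sum>i<n. cmod ((mat_adjoint X * T * Y) $$ (i, i))) \<le> entrywise_l1_norm T"
proof -
  note x = unitary_matD[OF X] and y = unitary_matD[OF Y]
  have xi: "mat_adjoint X $$ (i, a) = cnj (X $$ (a, i))" if "i < n" "a < n" for i a
    using x(1) that by auto
  have "cmod ((mat_adjoint X * T * Y) $$ (i, i)) \<le>
      (\<Sum>a<n. \<Sum>b<n. cmod (T $$ (a, b)) * (cmod (X $$ (a, i)) * cmod (Y $$ (b, i))))" if i: "i < n" for i
    unfolding index_mult_mat3[OF x(2) T y(1) i i]
    by (intro sum_norm_le) (simp add: xi i norm_mult mult_ac)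
  then have "(\<Sum>i<n. cmod ((mat_adjoint X * T * Y) $$ (i, i))) \<le>
      (\<Sum>i<n. \<Sum>a<n. \<Sum>b<n. cmod (T $$ (a, b)) * (cmod (X $$ (a, i)) * cmod (Y $$ (b, i))))"
    by (intro sum_mono) auto
  also have "\<dots> = (\<Sum>a<n. \<Sum>b<n. \<Sum>i<n. cmod (T $$ (a, b)) * (cmod (X $$ (a, i)) * cmod (Y $$ (b, i))))"
    by (subst sum.swap, rule sum.cong[OF refl], subst sum.swap) (rule refl)
  also have "\<dots> = (\<Sum>a<n. \<Sum>b<n. cmod (T $$ (a, b)) * (\<Sum>i<n. cmod (X $$ (a, i)) * cmod (Y $$ (b, i))))"
    by (simp add: sum_distrib_left)
  also have "\<dots> \<le> (\<Sum>a<n. \<Sum>b<n. cmod (T $$ (a, b)) * 1)"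
  proof (intro sum_mono mult_left_mono)
    fix a b assume "a \<in> {..<n}" "b \<in> {..<n}"
    then have rows: "(\<Sum>i<n. (cmod (X $$ (a, i)))\<^sup>2) = 1" "(\<Sum>i<n. (cmod (Y $$ (b, i)))\<^sup>2) = 1"
      using unitary_mat_row_norm[OF X] unitary_mat_row_norm[OF Y] by auto
    \<comment> \<open>The inequality \<open>2 * x * y\<close> \<le> \<open>x^2 + y^2\<close>, summed
      over \<open>i\<close>, replaces Cauchy-Schwarz here, since both rows have norm 1.\<close>
    have "(\<Sum>i<n. 2 * (cmod (X $$ (a, i)) * cmod (Y $$ (b, i)))) \<le>
        (\<Sum>i<n. (cmod (X $$ (a, i)))\<^sup>2 + (cmod (Y $$ (b, i)))\<^sup>2)"
      by (intro sum_mono) (metis mult.assoc sum_squares_bound)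
    then show "(\<Sum>i<n. cmod (X $$ (a, i)) * cmod (Y $$ (b, i))) \<le> 1"
      by (simp add: sum.distrib rows flip: sum_distrib_left)
  qed auto
  also have "\<dots> = entrywise_l1_norm T"
    using T by (simp add: entrywise_l1_norm_def)
  finally show ?thesis .
qed

text \<open>The Schur form of \<open>A\<close> is recovered from \<open>V * A * W\<close> by
  multiplying with the adjoint of \<open>V * U\<close> on the left and with
  \<open>mat_adjoint W * U\<close> on the right. Both factors are unitary, so the previous bound
  applies to the diagonal of eigenvalues.\<close>

lemma matrix_energy_le_l1_norm:
  assumes A: "A \<in> carrier_mat n n" and V: "unitary_mat n V" and W: "unitary_mat n W"
  shows "matrix_energy A \<le> entrywise_l1_norm (V * A * W)"
proof -
  obtain U B where U: "unitary_mat n U" and ut: "upper_triangular B"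
    and sim: "similar_mat_wit A B U (mat_adjoint U)"
    using unitary_schur[OF A] by auto
  note u = unitary_matD[OF U] and v = unitary_matD[OF V] and w = unitary_matD[OF W]
  have vu: "unitary_mat n (V * U)" and wu: "unitary_mat n (mat_adjoint W * U)"
    by (auto intro: unitary_mat_mult unitary_mat_adjoint U V W)
  have B: "B = mat_adjoint U * A * U"
    using similar_mat_witD2[OF _ similar_mat_wit_sym[OF sim], of n n] similar_mat_witD2[OF A sim]
    by auto
  have c: "A * U \<in> carrier_mat n n" "A * W \<in> carrier_mat n n" "mat_adjoint W * U \<in> carrier_mat n n"
     "V * (A * U) \<in> carrier_mat n n"
    using A u(1) w(1,2) v(1) by auto
  have "mat_adjoint (V * U) * (V * A * W) * (mat_adjoint W * U) =
      mat_adjoint U * (mat_adjoint V * (V * (A * (W * (mat_adjoint W * U)))))"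
    unfolding mat_adjoint_mult[OF v(1) u(1)] using A u(1,2) v(1,2) w(1,2) c
    by (simp add: assoc_mult_mat[of _ n n _ n _ n])
  also have "W * (mat_adjoint W * U) = U"
    using assoc_mult_mat[OF w(1) w(2) u(1)] u(1) by (simp add: w(4))
  also have "mat_adjoint V * (V * (A * U)) = A * U"
    using assoc_mult_mat[OF v(2) v(1) c(1)] by (simp add: v(3) left_mult_one_mat[OF c(1)])
  also have "mat_adjoint U * (A * U) = B"
    unfolding B using assoc_mult_mat[OF u(2) A u(1)] by simp
  finally have eq: "mat_adjoint (V * U) * (V * A * W) * (mat_adjoint W * U) = B" .
  have "similar_mat A B" using sim by (auto simp: similar_mat_def)
  then have "matrix_energy A = (\<Sum>i<n. cmod (B $$ (i, i)))"
    by (rule matrix_energy_similar_upper_triangular[OF A _ ut])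
  also have "\<dots> \<le> entrywise_l1_norm (V * A * W)"
    unfolding eq[symmetric]
    by (rule sum_cmod_diagonal_le_l1_norm[OF vu wu]) (use A v(1) w(1) in auto)
  finally show ?thesis .
qed

section \<open>Unitary invariance of the Frobenius norm and positivity of the energy\<close>

lemma frobenius_norm_unitary_left:
  assumes U: "unitary_mat n U" and M: "M \<in> carrier_mat n n"
  shows "frobenius_norm (U * M) = frobenius_norm M"
proof -
  note u = unitary_matD[OF U]
  \<comment> \<open>The squared Frobenius norm is the trace of \<open>mat_adjoint M * M\<close>, a
    product in which a unitary left factor of \<open>M\<close> cancels.\<close>
  have gram: "complex_of_real (\<Sum>x<n. \<Sum>y<n. (cmod (M $$ (x, y)))\<^sup>2) =
      (\<Sum>y<n. (mat_adjoint M * M) $$ (y, y))" if M: "M \<in> carrier_mat n n" for M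
  proof -
    have "complex_of_real (\<Sum>x<n. \<Sum>y<n. (cmod (M $$ (x, y)))\<^sup>2) =
        (\<Sum>y<n. \<Sum>x<n. cnj (M $$ (x, y)) * M $$ (x, y))"
      by (subst sum.swap) (simp add: complex_norm_square mult.commute del: of_real_power)
    also have "\<dots> = (\<Sum>y<n. (mat_adjoint M * M) $$ (y, y))"
      using M by (intro sum.cong) (auto simp: scalar_prod_def lessThan_atLeast0)
    finally show ?thesis .
  qed
  have UM: "U * M \<in> carrier_mat n n" using u(1) M by simp
  have M': "mat_adjoint M \<in> carrier_mat n n" using M by simp
  have "mat_adjoint (U * M) * (U * M) = mat_adjoint M * (mat_adjoint U * (U * M))"
    unfolding mat_adjoint_mult[OF u(1) M] by (rule assoc_mult_mat[OF M' u(2) UM])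
  also have "mat_adjoint U * (U * M) = M"
    using assoc_mult_mat[OF u(2) u(1) M] M by (simp add: u(3))
  finally have "complex_of_real (\<Sum>x<n. \<Sum>y<n. (cmod ((U * M) $$ (x, y)))\<^sup>2) =
      complex_of_real (\<Sum>x<n. \<Sum>y<n. (cmod (M $$ (x, y)))\<^sup>2)"
    unfolding gram[OF UM] gram[OF M] by (rule arg_cong)
  then have "(\<Sum>x<n. \<Sum>y<n. (cmod ((U * M) $$ (x, y)))\<^sup>2) = (\<Sum>x<n. \<Sum>y<n. (cmod (M $$ (x, y)))\<^sup>2)"
    unfolding of_real_eq_iff .
  then show ?thesis
    unfolding frobenius_norm_def carrier_matD[OF UM] carrier_matD[OF M] by (rule arg_cong)
qed

lemma frobenius_norm_adjoint: "frobenius_norm (mat_adjoint M) = frobenius_norm M"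
proof -
  have "(\<Sum>x<dim_col M. \<Sum>y<dim_row M. (cmod (mat_adjoint M $$ (x, y)))\<^sup>2) =
      (\<Sum>x<dim_col M. \<Sum>y<dim_row M. (cmod (M $$ (y, x)))\<^sup>2)"
    by (intro sum.cong) auto
  also have "\<dots> = (\<Sum>x<dim_row M. \<Sum>y<dim_col M. (cmod (M $$ (x, y)))\<^sup>2)"
    by (rule sum.swap)
  finally show ?thesis by (simp add: frobenius_norm_def)
qed

lemma frobenius_norm_unitary_right:
  assumes U: "unitary_mat n U" and M: "M \<in> carrier_mat n n"
  shows "frobenius_norm (M * U) = frobenius_norm M"
proof -
  have "frobenius_norm (M * U) = frobenius_norm (mat_adjoint U * mat_adjoint M)"
    by (simp only: frobenius_norm_adjoint flip: mat_adjoint_mult[OF M unitary_matD(1)[OF U]])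
  also have "\<dots> = frobenius_norm M"
    using frobenius_norm_unitary_left[OF unitary_mat_adjoint[OF U], of "mat_adjoint M"] M
    by (simp add: frobenius_norm_adjoint)
  finally show ?thesis .
qed

text \<open>A unitary Schur form of a Hermitian matrix is again Hermitian, hence diagonal. If the
  energy vanished, the diagonal would vanish as well, and unitary invariance would force
  \<open>A\<close> to have Frobenius norm 0.\<close>

lemma matrix_energy_pos:
  assumes A: "A \<in> carrier_mat n n" and herm: "mat_adjoint A = A" and nz: "frobenius_norm A \<noteq> 0"
  shows "matrix_energy A > 0"
proof (rule ccontr)
  assume "\<not> matrix_energy A > 0"
  then have E: "matrix_energy A = 0" using matrix_energy_nonneg[of A] by simp
  obtain U B where U: "unitary_mat n U" and ut: "upper_triangular B"
    and sim: "similar_mat_wit A B U (mat_adjoint U)"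
    using unitary_schur[OF A] by auto
  note u = unitary_matD[OF U]
  have B: "B \<in> carrier_mat n n" and AB: "A = U * B * mat_adjoint U"
    using similar_mat_witD2[OF A sim] by auto
  have BA: "B = mat_adjoint U * A * U"
    using similar_mat_witD2[OF B similar_mat_wit_sym[OF sim]] by auto
  have "mat_adjoint B = mat_adjoint U * mat_adjoint (mat_adjoint U * A)"
    unfolding BA using u(1,2) A by (intro mat_adjoint_mult) auto
  also have "mat_adjoint (mat_adjoint U * A) = A * U"
    using mat_adjoint_mult[OF u(2) A] by (simp add: herm)
  also have "mat_adjoint U * (A * U) = B"
    unfolding BA using assoc_mult_mat[OF u(2) A u(1)] by simp
  finally have hermB: "mat_adjoint B = B" .
  have "similar_mat A B" using sim by (auto simp: similar_mat_def)
  then have "(\<Sum>i<n. cmod (B $$ (i, i))) = 0"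
    using matrix_energy_similar_upper_triangular[OF A _ ut] E by simp
  then have diag: "B $$ (i, i) = 0" if "i < n" for i
    using that by (simp add: sum_nonneg_eq_0_iff)
  have low: "B $$ (i, j) = 0" if "j < i" "i < n" for i j
    using ut B that by (auto simp: upper_triangular_def)
  have "B $$ (i, j) = 0" if "i < n" "j < n" for i j
  proof (cases i j rule: linorder_cases)
    case less
    have "B $$ (i, j) = cnj (B $$ (j, i))"
      using index_mat_adjoint[of i B j] B that by (simp add: hermB)
    then show ?thesis using low[OF less that(2)] by simp
  qed (use that diag low in auto)
  then have "frobenius_norm B = 0"
    using B by (simp add: frobenius_norm_def)
  moreover have "frobenius_norm A = frobenius_norm B"
    unfolding AB using u(1) B
    by (subst frobenius_norm_unitary_right[OF unitary_mat_adjoint[OF U]])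
      (auto intro: frobenius_norm_unitary_left[OF U])
  ultimately show False using nz by simp
qed

section \<open>The Fourier matrix and adjacency matrices\<close>

text \<open>A geometric sum over the powers of an \<open>n\<close>-th root of unity. The frequency
  is an integer so that both differences of indices, for unitarity, and negated sums of indices, for
  the square of the Fourier matrix, are covered.\<close>

lemma sum_cis_roots_of_unity:
  fixes d :: int
  assumes n: "n > 0"
  shows "(\<Sum>x<n. cis (2 * pi * of_int d * real x / real n)) = (if int n dvd d then of_nat n else 0)"
proof -
  define w where "w = cis (2 * pi * of_int d / real n)"
  have pow: "w ^ x = cis (2 * pi * of_int d * real x / real n)" for x
    by (simp add: w_def DeMoivre mult_ac)
  have w1: "w = 1 \<longleftrightarrow> int n dvd d"
  proof
    assume "w = 1"
    then have "cos (2 * pi * of_int d / real n) = 1"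
      by (simp add: w_def complex_eq_iff)
    then obtain k :: int where "2 * pi * of_int d / real n = of_int k * 2 * pi"
      unfolding cos_one_2pi_int by auto
    then have "real_of_int d = of_int (k * int n)"
      using n by (simp add: field_simps)
    then have "d = k * int n" unfolding of_int_eq_iff .
    then show "int n dvd d" by simp
  next
    assume "int n dvd d"
    then obtain k where "d = int n * k" by blast
    then have "2 * pi * of_int d / real n = 2 * pi * of_int k" using n by simp
    then show "w = 1" unfolding w_def by (simp only: cis_multiple_2pi Ints_of_int)
  qed
  have "w ^ n = cis (2 * pi * of_int d)" using n by (simp add: pow)
  also have "\<dots> = 1" by (simp add: cis_multiple_2pi)
  finally have "w ^ n = 1" .
  then have "(\<Sum>x<n. w ^ x) = (if int n dvd d then of_nat n else 0)"
    using w1 by (auto simp: geometric_sum)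
  then show ?thesis by (simp add: pow)
qed

lemma fourier_matrix_carrier [simp]: "fourier_matrix n \<in> carrier_mat n n"
  by (simp add: fourier_matrix_def)

lemma index_fourier_matrix:
  assumes "m < n" "x < n"
  shows "fourier_matrix n $$ (m, x) =
    cis (- (2 * pi * real m * real x / real n)) / complex_of_real (sqrt (real n))"
  using assms by (simp add: fourier_matrix_def cis_conv_exp mult_ac)

lemma unitary_fourier_matrix: "unitary_mat n (fourier_matrix n)"
proof -
  let ?F = "fourier_matrix n"
  have "(mat_adjoint ?F * ?F) $$ (j, k) = (1\<^sub>m n :: complex mat) $$ (j, k)" if jk: "j < n" "k < n" for j k
  proof -
    have n: "n > 0" using jk by simp
    have "(mat_adjoint ?F * ?F) $$ (j, k) = (\<Sum>x<n. cnj (?F $$ (x, j)) * ?F $$ (x, k))"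
      using jk carrier_matD[OF fourier_matrix_carrier[of n]]
      by (simp add: scalar_prod_def lessThan_atLeast0)
    also have "\<dots> = (\<Sum>x<n. cis (2 * pi * of_int (int j - int k) * real x / real n) / of_nat n)"
    proof (rule sum.cong[OF refl])
      fix x assume "x \<in> {..<n}"
      then have x: "x < n" by simp
      have "complex_of_real (sqrt (real n)) * complex_of_real (sqrt (real n)) = of_nat n"
        by (simp flip: of_real_mult)
      then show "cnj (?F $$ (x, j)) * ?F $$ (x, k) =
          cis (2 * pi * of_int (int j - int k) * real x / real n) / of_nat n"
        using x jk by (simp add: index_fourier_matrix cis_cnj cis_mult diff_divide_distrib[symmetric]
            algebra_simps)
    qed
    also have "\<dots> = (if int n dvd int j - int k then of_nat n else 0) / of_nat n"
      by (simp only: sum_cis_roots_of_unity[OF n] flip: sum_divide_distrib)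
    \<comment> \<open>Two indices below \<open>n\<close> differ by less than \<open>n\<close> in
      absolute value, so only the difference 0 is divisible by \<open>n\<close>.\<close>
    also have "int n dvd int j - int k \<longleftrightarrow> j = k"
    proof
      assume dvd: "int n dvd int j - int k"
      show "j = k"
      proof (rule ccontr)
        assume "j \<noteq> k"
        then have "int j - int k \<noteq> 0" by simp
        from dvd_imp_le_int[OF this dvd] show False using jk by linarith
      qed
    qed simp
    finally show ?thesis using jk n by simp
  qed
  then have "mat_adjoint ?F * ?F = 1\<^sub>m n"
    by (rule eq_matI) (simp_all add: carrier_matD[OF fourier_matrix_carrier[of n]] del: index_mult_mat(1))
  then show ?thesis
    unfolding unitary_mat_def by simp
qed

text \<open>The square of the Fourier matrix is the permutation matrix of negation modulo
  \<open>n\<close>. An upper bound of 1 for every row sum is all that the triangle inequality later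
  asks for.\<close>

lemma l1_norm_fourier_square: "entrywise_l1_norm (fourier_matrix n * fourier_matrix n) \<le> real n"
proof -
  let ?F = "fourier_matrix n"
  note dF = carrier_matD[OF fourier_matrix_carrier[of n]]
  have entry: "(?F * ?F) $$ (m, k) = (if n dvd m + k then 1 else 0)" if mk: "m < n" "k < n" for m k
  proof -
    have n: "n > 0" using mk by simp
    have "(?F * ?F) $$ (m, k) = (\<Sum>x<n. ?F $$ (m, x) * ?F $$ (x, k))"
      using mk dF by (simp add: scalar_prod_def lessThan_atLeast0)
    also have "\<dots> = (\<Sum>x<n. cis (2 * pi * of_int (- int (m + k)) * real x / real n) / of_nat n)"
    proof (rule sum.cong[OF refl])
      fix x assume "x \<in> {..<n}"
      then have x: "x < n" by simp
      have sq: "complex_of_real (sqrt (real n)) * complex_of_real (sqrt (real n)) = of_nat n"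
        by (simp flip: of_real_mult)
      have "- (2 * pi * real m * real x / real n) + - (2 * pi * real x * real k / real n) =
          2 * pi * of_int (- int (m + k)) * real x / real n"
        using n by (simp add: field_simps)
      then show "?F $$ (m, x) * ?F $$ (x, k) =
          cis (2 * pi * of_int (- int (m + k)) * real x / real n) / of_nat n"
        unfolding index_fourier_matrix[OF mk(1) x] index_fourier_matrix[OF x mk(2)]
          times_divide_times_eq sq cis_mult by simp
    qed
    also have "\<dots> = (if int n dvd - int (m + k) then of_nat n else 0) / of_nat n"
      by (simp only: sum_cis_roots_of_unity[OF n] flip: sum_divide_distrib)
    also have "int n dvd - int (m + k) \<longleftrightarrow> n dvd m + k"
      unfolding dvd_minus_iff int_dvd_int_iff ..
    finally show ?thesis using n by simp
  qed
  have row: "(\<Sum>k<n. cmod ((?F * ?F) $$ (m, k))) \<le> 1" if m: "m < n" for m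
  proof -
    have "(\<Sum>k<n. cmod ((?F * ?F) $$ (m, k))) = (\<Sum>k<n. if n dvd m + k then 1 else 0)"
      by (intro sum.cong) (auto simp: entry m simp del: index_mult_mat)
    \<comment> \<open>The residue \<open>(n - m) mod n\<close> is the negative of \<open>m\<close>;
      the outer \<open>mod\<close> handles \<open>m = 0\<close>, where \<open>n - m\<close> would
      fall outside the index range.\<close>
    also have "\<dots> \<le> (\<Sum>k<n. if k = (n - m) mod n then 1 else 0)"
    proof (rule sum_mono)
      fix k assume "k \<in> {..<n}"
      then have k: "k < n" by simp
      have "k = (n - m) mod n" if "n dvd m + k"
      proof -
        obtain c where c: "m + k = n * c" using \<open>n dvd m + k\<close> by blast
        have "n * c < n * 2" using c m k by linarith
        then have "c = 0 \<or> c = 1" by auto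
        then show ?thesis
        proof
          assume "c = 1"
          then have "k = n - m" using c by simp
          then show ?thesis using k by simp
        qed (use c in simp)
      qed
      then show "(if n dvd m + k then 1 else 0 :: real) \<le> (if k = (n - m) mod n then 1 else 0)"
        by auto
    qed
    also have "\<dots> \<le> 1" by simp
    finally show ?thesis .
  qed
  have "entrywise_l1_norm (?F * ?F) = (\<Sum>m<n. \<Sum>k<n. cmod ((?F * ?F) $$ (m, k)))"
    using dF by (simp add: entrywise_l1_norm_def)
  also have "\<dots> \<le> (\<Sum>m<n. 1)"
    by (intro sum_mono row) auto
  finally show ?thesis by simp
qed

section \<open>Arcs, labelings and adjacency matrices\<close>

lemma pair_graph_arc_verts:
  assumes "pair_graph G" "(u, v) \<in> parcs G"
  shows "u \<in> pverts G" "v \<in> pverts G" "(v, u) \<in> parcs G" "u \<noteq> v"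
proof -
  interpret pair_graph G by fact
  show "u \<in> pverts G" "v \<in> pverts G" using assms(2) by (auto dest: in_arcsD1 in_arcsD2)
  show "(v, u) \<in> parcs G"
    using pair_sym_arcs assms(2) by (auto simp: symmetric_def dest: symD)
  show "u \<noteq> v" using pair_no_loops[OF assms(2)] by simp
qed

lemma pair_graph_finite:
  assumes "pair_graph G"
  shows "finite (pverts G)" "finite (parcs G)"
proof -
  interpret pair_graph G by fact
  show "finite (pverts G)" "finite (parcs G)" by (rule pair_finite_verts pair_finite_arcs)+
qed

text \<open>Forgetting the orientation maps arcs onto edges, and every fibre has exactly two
  elements because loops are excluded.\<close>

lemma card_arcs_eq:
  assumes G: "pair_graph G"
  shows "card (parcs G) = 2 * num_edges G"
proof -
  let ?f = "\<lambda>(u, v). {u, v}"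
  have "num_edges G = card (?f ` parcs G)"
    unfolding num_edges_def by (rule arg_cong[where f = card]) auto
  moreover have "card (parcs G) = (\<Sum>e\<in>?f ` parcs G. card {a \<in> parcs G. ?f a = e})"
    unfolding card_eq_sum by (rule sum.image_gen[OF pair_graph_finite(2)[OF G]])
  moreover have "card {a \<in> parcs G. ?f a = e} = 2" if e: "e \<in> ?f ` parcs G" for e
  proof -
    obtain u v where uv: "(u, v) \<in> parcs G" "e = {u, v}" using e by auto
    note uv' = pair_graph_arc_verts[OF G uv(1)]
    have "(p, q) \<in> parcs G \<and> {p, q} = e \<longleftrightarrow> (p, q) = (u, v) \<or> (p, q) = (v, u)" for p q
      unfolding uv(2) doubleton_eq_iff Pair_inject using uv(1) uv'(3) by blast
    then have "{a \<in> parcs G. ?f a = e} = {(u, v), (v, u)}"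
      unfolding set_eq_iff split_paired_All by simp
    then show ?thesis using uv'(4) by simp
  qed
  ultimately show ?thesis by simp
qed

lemma labelingsD:
  assumes "\<sigma> \<in> labelings G"
  shows "bij_betw \<sigma> (pverts G) {..<card (pverts G)}"
  using assms by (simp add: labelings_def)

lemma adj_matrix_carrier [simp]:
  "adj_matrix G \<sigma> \<in> carrier_mat (card (pverts G)) (card (pverts G))"
  by (simp add: adj_matrix_def)

lemma index_adj_matrix:
  assumes "\<sigma> \<in> labelings G" "u \<in> pverts G" "v \<in> pverts G"
  shows "adj_matrix G \<sigma> $$ (\<sigma> u, \<sigma> v) = of_bool ((u, v) \<in> parcs G)"
proof -
  note s = labelingsD[OF assms(1)]
  have "\<sigma> w < card (pverts G) \<and> inv_into (pverts G) \<sigma> (\<sigma> w) = w" if "w \<in> pverts G" for w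
    using s that by (auto simp: bij_betw_def)
  then show ?thesis using assms by (simp add: adj_matrix_def)
qed

lemma labelings_surj:
  assumes "\<sigma> \<in> labelings G" "i < card (pverts G)"
  obtains u where "u \<in> pverts G" "\<sigma> u = i"
proof -
  have "i \<in> \<sigma> ` pverts G" using labelingsD[OF assms(1)] assms(2) by (simp add: bij_betw_def)
  then show thesis using that by auto
qed

lemma mat_adjoint_adj_matrix:
  assumes G: "pair_graph G" and s: "\<sigma> \<in> labelings G"
  shows "mat_adjoint (adj_matrix G \<sigma>) = adj_matrix G \<sigma>"
proof (rule eq_matI)
  note dA = carrier_matD[OF adj_matrix_carrier[of G \<sigma>]]
  fix i j assume "i < dim_row (adj_matrix G \<sigma>)" "j < dim_col (adj_matrix G \<sigma>)"
  then have ij: "i < card (pverts G)" "j < card (pverts G)" by (simp_all add: dA)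
  obtain u v where uv: "u \<in> pverts G" "\<sigma> u = i" "v \<in> pverts G" "\<sigma> v = j"
    using labelings_surj[OF s ij(1)] labelings_surj[OF s ij(2)] by metis
  have "mat_adjoint (adj_matrix G \<sigma>) $$ (i, j) = cnj (adj_matrix G \<sigma> $$ (j, i))"
    using ij by (intro index_mat_adjoint) (simp_all add: dA)
  also have "\<dots> = adj_matrix G \<sigma> $$ (i, j)"
    using index_adj_matrix[OF s uv(1,3)] index_adj_matrix[OF s uv(3,1)] uv
      pair_graph_arc_verts(3)[OF G] by auto
  finally show "mat_adjoint (adj_matrix G \<sigma>) $$ (i, j) = adj_matrix G \<sigma> $$ (i, j)" .
qed (simp_all add: carrier_matD[OF adj_matrix_carrier])

text \<open>The entries are 0 or 1, so the squared norm counts arcs. In particular it does not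
  depend on the labeling.\<close>

lemma frobenius_norm_adj_matrix:
  assumes G: "pair_graph G" and s: "\<sigma> \<in> labelings G"
  shows "frobenius_norm (adj_matrix G \<sigma>) = sqrt (2 * real (num_edges G))"
proof -
  let ?A = "adj_matrix G \<sigma>" and ?V = "pverts G"
  note bij = labelingsD[OF s]
  have "(\<Sum>x<card ?V. \<Sum>y<card ?V. (cmod (?A $$ (x, y)))\<^sup>2) =
      (\<Sum>u\<in>?V. \<Sum>v\<in>?V. (cmod (?A $$ (\<sigma> u, \<sigma> v)))\<^sup>2)"
    by (simp flip: sum.reindex_bij_betw[OF bij])
  also have "\<dots> = (\<Sum>(u, v)\<in>?V \<times> ?V. of_bool ((u, v) \<in> parcs G))"
    unfolding sum.cartesian_product
    by (intro sum.cong) (auto simp: index_adj_matrix[OF s])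
  also have "\<dots> = real (card ((?V \<times> ?V) \<inter> parcs G))"
    using pair_graph_finite[OF G] by (simp add: case_prod_beta' of_bool_def sum.If_cases)
  also have "(?V \<times> ?V) \<inter> parcs G = parcs G"
    using pair_graph_arc_verts(1,2)[OF G] by auto
  finally show ?thesis
    by (simp add: frobenius_norm_def carrier_matD[OF adj_matrix_carrier] card_arcs_eq[OF G])
qed

section \<open>Kronecker products and the energy of the strong product\<close>

text \<open>The numbering \<open>\<pi>\<close> of index pairs is left arbitrary so that two
  instances are available: the lexicographic one for the energy and the one adapted to the Fourier
  matrix for coprime orders.\<close>

lemma strong_product_labeling:
  assumes G: "pair_graph G" and H: "pair_graph H"
    and s: "\<sigma> \<in> labelings G" and t: "\<tau> \<in> labelings H"
    and pi: "bij_betw \<pi> ({..<card (pverts G)} \<times> {..<card (pverts H)})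
      {..<card (pverts G) * card (pverts H)}"
  obtains \<rho> where "\<rho> \<in> labelings (strong_product G H)"
    and "\<And>a b c d. \<lbrakk>a < card (pverts G); b < card (pverts H); c < card (pverts G); d < card (pverts H)\<rbrakk> \<Longrightarrow>
      adj_matrix (strong_product G H) \<rho> $$ (\<pi> (a, b), \<pi> (c, d)) =
        adj_matrix G \<sigma> $$ (a, c) * adj_matrix H \<tau> $$ (b, d) +
        adj_matrix G \<sigma> $$ (a, c) * of_bool (b = d) +
        of_bool (a = c) * adj_matrix H \<tau> $$ (b, d)"
proof -
  define S where "S = strong_product G H"
  define \<rho> where "\<rho> = restrict (\<pi> \<circ> map_prod \<sigma> \<tau>) (pverts S)"
  have VS: "pverts S = pverts G \<times> pverts H" by (simp add: S_def strong_product_def)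
  have cardS: "card (pverts S) = card (pverts G) * card (pverts H)"
    by (simp add: VS card_cartesian_product)
  have "bij_betw (\<pi> \<circ> map_prod \<sigma> \<tau>) (pverts S) {..<card (pverts S)}"
    unfolding VS card_cartesian_product
    using bij_betw_map_prod[OF labelingsD[OF s] labelingsD[OF t]] pi by (rule bij_betw_trans)
  then have "bij_betw \<rho> (pverts S) {..<card (pverts S)}"
    by (subst bij_betw_cong[where g = "\<pi> \<circ> map_prod \<sigma> \<tau>"]) (simp_all add: \<rho>_def)
  then have r: "\<rho> \<in> labelings S" by (simp add: labelings_def \<rho>_def)
  have "adj_matrix S \<rho> $$ (\<pi> (a, b), \<pi> (c, d)) =
        adj_matrix G \<sigma> $$ (a, c) * adj_matrix H \<tau> $$ (b, d) +
        adj_matrix G \<sigma> $$ (a, c) * of_bool (b = d) +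
        of_bool (a = c) * adj_matrix H \<tau> $$ (b, d)"
    if ab: "a < card (pverts G)" "b < card (pverts H)" and cd: "c < card (pverts G)" "d < card (pverts H)"
    for a b c d
  proof -
    obtain u where u: "u \<in> pverts G" "\<sigma> u = a" by (rule labelings_surj[OF s ab(1)])
    obtain v where v: "v \<in> pverts H" "\<tau> v = b" by (rule labelings_surj[OF t ab(2)])
    obtain u' where u': "u' \<in> pverts G" "\<sigma> u' = c" by (rule labelings_surj[OF s cd(1)])
    obtain v' where v': "v' \<in> pverts H" "\<tau> v' = d" by (rule labelings_surj[OF t cd(2)])
    have eqs: "a = c \<longleftrightarrow> u = u'" "b = d \<longleftrightarrow> v = v'"
      unfolding u(2)[symmetric] v(2)[symmetric] u'(2)[symmetric] v'(2)[symmetric]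
      using bij_betw_imp_inj_on[OF labelingsD[OF s]] bij_betw_imp_inj_on[OF labelingsD[OF t]] u(1) v(1) u'(1) v'(1)
      by (simp_all add: inj_on_eq_iff)
    have rho: "\<pi> (a, b) = \<rho> (u, v)" "\<pi> (c, d) = \<rho> (u', v')"
      using u v u' v' by (simp_all add: \<rho>_def VS)
    have "adj_matrix S \<rho> $$ (\<pi> (a, b), \<pi> (c, d)) = of_bool (((u, v), (u', v')) \<in> parcs S)"
      unfolding rho by (rule index_adj_matrix[OF r]) (use u(1) v(1) u'(1) v'(1) VS in simp_all)
    moreover have "adj_matrix G \<sigma> $$ (a, c) = of_bool ((u, u') \<in> parcs G)"
      using index_adj_matrix[OF s u(1) u'(1)] u(2) u'(2) by simp
    moreover have "adj_matrix H \<tau> $$ (b, d) = of_bool ((v, v') \<in> parcs H)"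
      using index_adj_matrix[OF t v(1) v'(1)] v(2) v'(2) by simp
    moreover have "((u, v), (u', v')) \<in> parcs S \<longleftrightarrow>
        (u, u') \<in> parcs G \<and> (v, v') \<in> parcs H \<or> u = u' \<and> (v, v') \<in> parcs H \<or> v = v' \<and> (u, u') \<in> parcs G"
      using u(1) v(1) u'(1) v'(1) by (simp add: S_def strong_product_def weak_product_def cartesian_product_def)
    \<comment> \<open>Without loops the three kinds of adjacency exclude one another, so the
      indicator of their disjunction is the sum of the three indicators.\<close>
    moreover have "(u, u') \<in> parcs G \<Longrightarrow> u \<noteq> u'" "(v, v') \<in> parcs H \<Longrightarrow> v \<noteq> v'"
      using pair_graph_arc_verts(4)[OF G] pair_graph_arc_verts(4)[OF H] by auto
    ultimately show ?thesis unfolding eqs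
      by (cases "(u, u') \<in> parcs G"; cases "(v, v') \<in> parcs H"; cases "u = u'"; cases "v = v'") simp_all
  qed
  with r show thesis unfolding S_def by (rule that)
qed

section \<open>Kronecker products in lexicographic order\<close>

definition kronecker :: "'a :: times mat \<Rightarrow> 'a mat \<Rightarrow> 'a mat" where
  "kronecker A B = mat (dim_row A * dim_row B) (dim_col A * dim_col B)
     (\<lambda>(i, j). A $$ (i div dim_row B, j div dim_col B) * B $$ (i mod dim_row B, j mod dim_col B))"

lemma lex_index_less:
  assumes "a < n" "b < (m::nat)"
  shows "a * m + b < n * m"
proof -
  have "a * m + b < Suc a * m" using assms(2) by simp
  also have "\<dots> \<le> n * m" using assms(1) by (intro mult_right_mono) auto
  finally show ?thesis .
qed

lemma lex_index_divmod:
  assumes "k < n * (m::nat)"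
  shows "k div m < n" "k mod m < m"
proof -
  have "m > 0" using assms by (cases m) auto
  then show "k mod m < m" by simp
  show "k div m < n" using assms by (rule less_mult_imp_div_less)
qed

lemma bij_betw_lex_index:
  "bij_betw (\<lambda>(a, b). a * m + b) ({..<n} \<times> {..<m}) {..<n * (m::nat)}"
  by (rule bij_betw_byWitness[where f' = "\<lambda>k. (k div m, k mod m)"])
    (auto simp: lex_index_less lex_index_divmod)

lemma sum_lex_index:
  "(\<Sum>k<n * m. f (k div m) (k mod m)) = (\<Sum>a<n. \<Sum>b<(m::nat). f a b)"
proof -
  have "(\<Sum>k<n * m. f (k div m) (k mod m)) =
      (\<Sum>p\<in>{..<n} \<times> {..<m}. f ((case p of (a, b) \<Rightarrow> a * m + b) div m) ((case p of (a, b) \<Rightarrow> a * m + b) mod m))"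
    by (rule sum.reindex_bij_betw[OF bij_betw_lex_index, symmetric])
  also have "\<dots> = (\<Sum>(a, b)\<in>{..<n} \<times> {..<m}. f a b)"
    by (intro sum.cong) auto
  finally show ?thesis by (simp add: sum.cartesian_product)
qed

lemma kronecker_carrier:
  assumes "A \<in> carrier_mat n n" "B \<in> carrier_mat m m"
  shows "kronecker A B \<in> carrier_mat (n * m) (n * m)"
  using assms by (simp add: kronecker_def)

lemma index_kronecker:
  assumes "A \<in> carrier_mat n n" "B \<in> carrier_mat m m" "i < n * m" "j < n * m"
  shows "kronecker A B $$ (i, j) = A $$ (i div m, j div m) * B $$ (i mod m, j mod m)"
  using assms by (simp add: kronecker_def)

text \<open>The mixed-product rule: summation over the joint index becomes summation over pairs, and
  the summand separates.\<close>

lemma kronecker_mult: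
  fixes A B C D :: "'a :: comm_semiring_0 mat"
  assumes A: "A \<in> carrier_mat n n" and C: "C \<in> carrier_mat n n"
    and B: "B \<in> carrier_mat m m" and D: "D \<in> carrier_mat m m"
  shows "kronecker A B * kronecker C D = kronecker (A * C) (B * D)"
proof (rule eq_matI)
  note K1 = kronecker_carrier[OF A B] and K2 = kronecker_carrier[OF C D]
  have AC: "A * C \<in> carrier_mat n n" and BD: "B * D \<in> carrier_mat m m" using A B C D by auto
  note K = kronecker_carrier[OF AC BD]
  fix i j assume "i < dim_row (kronecker (A * C) (B * D))" "j < dim_col (kronecker (A * C) (B * D))"
  then have ij: "i < n * m" "j < n * m" using K by auto
  note i = lex_index_divmod[OF ij(1)] and j = lex_index_divmod[OF ij(2)]
  have "(kronecker A B * kronecker C D) $$ (i, j) =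
      (\<Sum>k<n * m. kronecker A B $$ (i, k) * kronecker C D $$ (k, j))"
    using K1 K2 ij by (simp add: scalar_prod_def lessThan_atLeast0)
  also have "\<dots> = (\<Sum>k<n * m. (A $$ (i div m, k div m) * B $$ (i mod m, k mod m)) *
      (C $$ (k div m, j div m) * D $$ (k mod m, j mod m)))"
    using ij by (intro sum.cong) (simp_all add: index_kronecker[OF A B] index_kronecker[OF C D])
  also have "\<dots> = (\<Sum>a<n. \<Sum>b<m. (A $$ (i div m, a) * B $$ (i mod m, b)) * (C $$ (a, j div m) * D $$ (b, j mod m)))"
    by (rule sum_lex_index[of "\<lambda>a b. (A $$ (i div m, a) * B $$ (i mod m, b)) * (C $$ (a, j div m) * D $$ (b, j mod m))"])
  also have "\<dots> = (\<Sum>a<n. A $$ (i div m, a) * C $$ (a, j div m)) * (\<Sum>b<m. B $$ (i mod m, b) * D $$ (b, j mod m))"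
    unfolding sum_product by (simp add: mult_ac)
  also have "\<dots> = (A * C) $$ (i div m, j div m) * (B * D) $$ (i mod m, j mod m)"
    using A B C D i j by (simp add: scalar_prod_def lessThan_atLeast0)
  also have "\<dots> = kronecker (A * C) (B * D) $$ (i, j)"
    by (rule index_kronecker[OF AC BD ij, symmetric])
  finally show "(kronecker A B * kronecker C D) $$ (i, j) = kronecker (A * C) (B * D) $$ (i, j)" .
qed (use A B C D in \<open>simp_all add: kronecker_def\<close>)

lemma lex_index_eq_iff: "i = j \<longleftrightarrow> i div m = j div m \<and> i mod m = j mod (m::nat)"
  by (metis div_mult_mod_eq)

lemma kronecker_one: "kronecker (1\<^sub>m n) (1\<^sub>m m) = (1\<^sub>m (n * m) :: 'a :: semiring_1 mat)"
proof (rule eq_matI)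
  fix i j assume "i < dim_row (1\<^sub>m (n * m) :: 'a mat)" "j < dim_col (1\<^sub>m (n * m) :: 'a mat)"
  then have ij: "i < n * m" "j < n * m" by auto
  show "kronecker (1\<^sub>m n) (1\<^sub>m m) $$ (i, j) = (1\<^sub>m (n * m) :: 'a mat) $$ (i, j)"
    using ij lex_index_divmod[OF ij(1)] lex_index_divmod[OF ij(2)] lex_index_eq_iff[of i j m]
    by (auto simp: index_kronecker[of _ n _ m])
qed (simp_all add: kronecker_def)

text \<open>By the mixed-product rule, Kronecker products of the conjugating matrices conjugate
  Kronecker products. Two triangular forms thereby combine into one for the product.\<close>

lemma similar_mat_wit_kronecker:
  fixes A B :: "'a :: comm_semiring_1 mat"
  assumes "similar_mat_wit A A' P Q" "similar_mat_wit B B' R S"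
  shows "similar_mat_wit (kronecker A B) (kronecker A' B') (kronecker P R) (kronecker Q S)"
proof -
  define n m where "n = dim_row A" and "m = dim_row B"
  note a = similar_mat_witD[OF n_def assms(1)] and b = similar_mat_witD[OF m_def assms(2)]
  have AP: "P * A' \<in> carrier_mat n n" "R * B' \<in> carrier_mat m m" using a b by auto
  show ?thesis
  proof (rule similar_mat_witI[of _ _ "n * m"])
    show "kronecker P R * kronecker Q S = 1\<^sub>m (n * m)"
      unfolding kronecker_mult[OF a(6,7) b(6,7)] a(1) b(1) by (rule kronecker_one)
    show "kronecker Q S * kronecker P R = 1\<^sub>m (n * m)"
      unfolding kronecker_mult[OF a(7,6) b(7,6)] a(2) b(2) by (rule kronecker_one)
    show "kronecker A B = kronecker P R * kronecker A' B' * kronecker Q S"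
      unfolding kronecker_mult[OF a(6,5) b(6,5)] kronecker_mult[OF AP(1) a(7) AP(2) b(7)]
      using a(3) b(3) by simp
  qed (use a b in \<open>auto intro: kronecker_carrier\<close>)
qed

text \<open>A position below the diagonal is below it lexicographically: either the quotients
  already lie below the diagonal of \<open>A\<close>, or they agree and the remainders lie below the
  diagonal of \<open>B\<close>. One factor vanishes in each case.\<close>

lemma upper_triangular_kronecker:
  fixes A B :: "'a :: semiring_0 mat"
  assumes A: "A \<in> carrier_mat n n" "upper_triangular A" and B: "B \<in> carrier_mat m m" "upper_triangular B"
  shows "upper_triangular (kronecker A B)"
proof (rule upper_triangularI)
  fix i j assume ji: "j < i" and "i < dim_row (kronecker A B)"
  then have ij: "i < n * m" "j < n * m" using kronecker_carrier[OF A(1) B(1)] by auto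
  note i = lex_index_divmod[OF ij(1)] and j = lex_index_divmod[OF ij(2)]
  have "j div m \<le> i div m" using ji by (intro div_le_mono) simp
  then consider "j div m < i div m" | "j div m = i div m" "j mod m < i mod m"
    using ji by (metis div_mult_mod_eq le_neq_implies_less nat_add_left_cancel_less)
  then show "kronecker A B $$ (i, j) = 0"
    using A B i j by cases (auto simp: index_kronecker[OF A(1) B(1) ij] upper_triangular_def)
qed

lemma upper_triangular_char_matrix:
  "A \<in> carrier_mat n n \<Longrightarrow> upper_triangular A \<Longrightarrow> upper_triangular (char_matrix A e)"
  by (auto simp: upper_triangular_def char_matrix_def)

lemma graph_energy_strong_product_ge:
  assumes G: "pair_graph G" and H: "pair_graph H"
  shows "graph_energy (strong_product G H) \<ge> graph_energy G * graph_energy H -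
    real (card (pverts H)) * graph_energy G - real (card (pverts G)) * graph_energy H"
proof -
  define n m where "n = card (pverts G)" and "m = card (pverts H)"
  obtain \<sigma> \<tau> where s: "\<sigma> \<in> labelings G" and t: "\<tau> \<in> labelings H"
    using labelings_nonempty[OF pair_graph_finite(1)[OF G]] labelings_nonempty[OF pair_graph_finite(1)[OF H]]
    by auto
  obtain \<rho> where r: "\<rho> \<in> labelings (strong_product G H)"
    and adj: "\<And>a b c d. \<lbrakk>a < n; b < m; c < n; d < m\<rbrakk> \<Longrightarrow>
      adj_matrix (strong_product G H) \<rho> $$ (case (a, b) of (a, b) \<Rightarrow> a * m + b, case (c, d) of (a, b) \<Rightarrow> a * m + b) =
        adj_matrix G \<sigma> $$ (a, c) * adj_matrix H \<tau> $$ (b, d) +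
        adj_matrix G \<sigma> $$ (a, c) * of_bool (b = d) +
        of_bool (a = c) * adj_matrix H \<tau> $$ (b, d)"
    using strong_product_labeling[OF G H s t bij_betw_lex_index] unfolding n_def m_def by blast
  define A B M where "A = adj_matrix G \<sigma>" and "B = adj_matrix H \<tau>"
    and "M = adj_matrix (strong_product G H) \<rho>"
  have A: "A \<in> carrier_mat n n" and B: "B \<in> carrier_mat m m"
    by (simp_all add: A_def B_def n_def m_def)
  have M: "M \<in> carrier_mat (n * m) (n * m)"
    using adj_matrix_carrier[of "strong_product G H" \<rho>]
    by (simp add: M_def n_def m_def strong_product_def card_cartesian_product)
  have cA: "char_matrix A (- 1) \<in> carrier_mat n n" and cB: "char_matrix B (- 1) \<in> carrier_mat m m"
    using A B by auto
  \<comment> \<open>Since \<open>char_matrix X e\<close> is \<open>X\<close> minus \<open>e\<close>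
    times the identity, this says that \<open>M\<close> is the Kronecker product of
    \<open>A + I\<close> and \<open>B + I\<close>, minus \<open>I\<close>. Writing the shifts as
    \<open>char_matrix\<close> lets \<open>similar_mat_wit_char_matrix\<close> carry similarity
    through them.\<close>
  have M_eq: "M = char_matrix (kronecker (char_matrix A (- 1)) (char_matrix B (- 1))) 1"
  proof (rule eq_matI)
    fix i j
    assume "i < dim_row (char_matrix (kronecker (char_matrix A (- 1)) (char_matrix B (- 1))) 1)"
      "j < dim_col (char_matrix (kronecker (char_matrix A (- 1)) (char_matrix B (- 1))) 1)"
    then have ij: "i < n * m" "j < n * m"
      using char_matrix_closed[OF kronecker_carrier[OF cA cB], of 1] by auto
    note i = lex_index_divmod[OF ij(1)] and j = lex_index_divmod[OF ij(2)]
    have "M $$ (i, j) = A $$ (i div m, j div m) * B $$ (i mod m, j mod m) +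
        A $$ (i div m, j div m) * of_bool (i mod m = j mod m) +
        of_bool (i div m = j div m) * B $$ (i mod m, j mod m)"
      using adj[OF i j] by (simp add: M_def A_def B_def)
    also have "\<dots> = (A $$ (i div m, j div m) + of_bool (i div m = j div m)) *
        (B $$ (i mod m, j mod m) + of_bool (i mod m = j mod m)) - of_bool (i = j)"
      using lex_index_eq_iff[of i j m] by (auto simp: algebra_simps)
    also have "\<dots> = char_matrix (kronecker (char_matrix A (- 1)) (char_matrix B (- 1))) 1 $$ (i, j)"
      using index_kronecker[OF cA cB ij] kronecker_carrier[OF cA cB] A B i j ij
      by (auto simp: char_matrix_def)
    finally show "M $$ (i, j) = char_matrix (kronecker (char_matrix A (- 1)) (char_matrix B (- 1))) 1 $$ (i, j)" .
  next
    show "dim_row M = dim_row (char_matrix (kronecker (char_matrix A (- 1)) (char_matrix B (- 1))) 1)"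
      "dim_col M = dim_col (char_matrix (kronecker (char_matrix A (- 1)) (char_matrix B (- 1))) 1)"
      using M char_matrix_closed[OF kronecker_carrier[OF cA cB], of 1] by auto
  qed
  obtain P T where simA: "similar_mat_wit A T P (mat_adjoint P)" and utT: "upper_triangular T"
    using unitary_schur[OF A] by auto
  obtain R S where simB: "similar_mat_wit B S R (mat_adjoint R)" and utS: "upper_triangular S"
    using unitary_schur[OF B] by auto
  have T: "T \<in> carrier_mat n n" and S: "S \<in> carrier_mat m m"
    using similar_mat_witD2[OF A simA] similar_mat_witD2[OF B simB] by auto
  have cT: "char_matrix T (- 1) \<in> carrier_mat n n" and cS: "char_matrix S (- 1) \<in> carrier_mat m m"
    using T S by auto
  define K where "K = kronecker (char_matrix T (- 1)) (char_matrix S (- 1))"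
  have K: "K \<in> carrier_mat (n * m) (n * m)" unfolding K_def by (rule kronecker_carrier[OF cT cS])
  have "similar_mat M (char_matrix K 1)"
    unfolding M_eq K_def similar_mat_def
    using similar_mat_wit_char_matrix[OF similar_mat_wit_kronecker[OF
        similar_mat_wit_char_matrix[OF simA] similar_mat_wit_char_matrix[OF simB]]] by blast
  moreover have "upper_triangular (char_matrix K 1)"
    unfolding K_def
    by (intro upper_triangular_char_matrix[OF K[unfolded K_def]] upper_triangular_kronecker[OF cT _ cS]
        upper_triangular_char_matrix[OF T utT] upper_triangular_char_matrix[OF S utS])
  ultimately have "matrix_energy M = (\<Sum>k<n * m. cmod (char_matrix K 1 $$ (k, k)))"
    by (rule matrix_energy_similar_upper_triangular[OF M])
  also have "\<dots> = (\<Sum>k<n * m. cmod ((T $$ (k div m, k div m) + 1) * (S $$ (k mod m, k mod m) + 1) - 1))"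
  proof (rule sum.cong[OF refl])
    fix k assume "k \<in> {..<n * m}"
    then have k: "k < n * m" by simp
    show "cmod (char_matrix K 1 $$ (k, k)) =
        cmod ((T $$ (k div m, k div m) + 1) * (S $$ (k mod m, k mod m) + 1) - 1)"
      using index_kronecker[OF cT cS k k] K T S k lex_index_divmod[OF k]
      by (simp add: char_matrix_def K_def)
  qed
  also have "\<dots> = (\<Sum>a<n. \<Sum>b<m. cmod ((T $$ (a, a) + 1) * (S $$ (b, b) + 1) - 1))"
    by (rule sum_lex_index[of "\<lambda>a b. cmod ((T $$ (a, a) + 1) * (S $$ (b, b) + 1) - 1)"])
  also have "\<dots> \<ge> (\<Sum>a<n. \<Sum>b<m. cmod (T $$ (a, a)) * cmod (S $$ (b, b)) -
      cmod (T $$ (a, a)) - cmod (S $$ (b, b)))"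
  proof (intro sum_mono)
    fix a b
    have eq: "T $$ (a, a) * S $$ (b, b) =
        ((T $$ (a, a) + 1) * (S $$ (b, b) + 1) - 1) - T $$ (a, a) - S $$ (b, b)"
      by (simp add: algebra_simps)
    have "cmod (T $$ (a, a)) * cmod (S $$ (b, b)) = cmod (T $$ (a, a) * S $$ (b, b))"
      by (simp add: norm_mult)
    also have "\<dots> \<le> cmod (((T $$ (a, a) + 1) * (S $$ (b, b) + 1) - 1) - T $$ (a, a)) + cmod (S $$ (b, b))"
      unfolding eq by (rule norm_triangle_ineq4)
    also have "cmod (((T $$ (a, a) + 1) * (S $$ (b, b) + 1) - 1) - T $$ (a, a)) \<le>
        cmod ((T $$ (a, a) + 1) * (S $$ (b, b) + 1) - 1) + cmod (T $$ (a, a))"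
      by (rule norm_triangle_ineq4)
    finally show "cmod (T $$ (a, a)) * cmod (S $$ (b, b)) - cmod (T $$ (a, a)) - cmod (S $$ (b, b)) \<le>
        cmod ((T $$ (a, a) + 1) * (S $$ (b, b) + 1) - 1)" by simp
  qed
  \<comment> \<open>Each eigenvalue of \<open>A\<close> meets all \<open>m\<close> eigenvalues of
    \<open>B\<close> and conversely, which is how the orders enter the bound.\<close>
  also have "(\<Sum>a<n. \<Sum>b<m. cmod (T $$ (a, a)) * cmod (S $$ (b, b)) -
      cmod (T $$ (a, a)) - cmod (S $$ (b, b))) =
      (\<Sum>a<n. cmod (T $$ (a, a))) * (\<Sum>b<m. cmod (S $$ (b, b))) -
      real m * (\<Sum>a<n. cmod (T $$ (a, a))) - real n * (\<Sum>b<m. cmod (S $$ (b, b)))"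
    unfolding sum_product by (simp add: sum_subtractf sum_distrib_left)
  also have "(\<Sum>a<n. cmod (T $$ (a, a))) = graph_energy G"
    using matrix_energy_similar_upper_triangular[OF A _ utT] simA
    unfolding graph_energy_eq[OF s] A_def[symmetric] similar_mat_def by metis
  also have "(\<Sum>b<m. cmod (S $$ (b, b))) = graph_energy H"
    using matrix_energy_similar_upper_triangular[OF B _ utS] simB
    unfolding graph_energy_eq[OF t] B_def[symmetric] similar_mat_def by metis
  finally show ?thesis
    unfolding graph_energy_eq[OF r] M_def n_def m_def .
qed

section \<open>Labelings by the Chinese remainder theorem\<close>

lemma cis_cong:
  assumes "[j = k] (mod int n)" and n: "n > 0"
  shows "cis (2 * pi * of_int j / real n) = cis (2 * pi * of_int k / real n)"
proof -
  obtain c where c: "j = k + int n * c"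
    using assms(1) by (metis cong_iff_lin cong_sym)
  have "2 * pi * of_int j / real n = 2 * pi * of_int k / real n + 2 * pi * of_int c"
    using n by (simp add: c field_simps)
  then have "cis (2 * pi * of_int j / real n) =
      cis (2 * pi * of_int k / real n) * cis (2 * pi * of_int c)"
    by (simp only: cis_mult)
  also have "cis (2 * pi * of_int c) = 1" by (simp only: cis_multiple_2pi Ints_of_int)
  finally show ?thesis by simp
qed

text \<open>The Chinese remainder theorem, by injectivity and counting. It reindexes the frequencies
  of the transform, whereas \<open>crt_index\<close> below reindexes the vertices.\<close>

lemma bij_betw_residues:
  assumes "coprime n (m::nat)"
  shows "bij_betw (\<lambda>k. (k mod n, k mod m)) {..<n * m} ({..<n} \<times> {..<m})"
proof -
  have inj: "inj_on (\<lambda>k. (k mod n, k mod m)) {..<n * m}"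
  proof (rule inj_onI)
    fix x y assume xy: "x \<in> {..<n * m}" "y \<in> {..<n * m}" "(x mod n, x mod m) = (y mod n, y mod m)"
    then have "[x = y] (mod n * m)"
      by (intro coprime_cong_mult_nat assms) (simp_all add: cong_def)
    then show "x = y" using xy by (simp add: cong_def)
  qed
  have "(\<lambda>k. (k mod n, k mod m)) ` {..<n * m} \<subseteq> {..<n} \<times> {..<m}"
  proof
    fix p assume "p \<in> (\<lambda>k. (k mod n, k mod m)) ` {..<n * m}"
    then obtain k where k: "k < n * m" "p = (k mod n, k mod m)" by auto
    then have "n > 0" "m > 0" by (metis gr0I mult_0 not_less_zero, metis gr0I mult_0_right not_less_zero)
    then show "p \<in> {..<n} \<times> {..<m}" using k(2) by simp
  qed
  moreover have "card ((\<lambda>k. (k mod n, k mod m)) ` {..<n * m}) = card ({..<n} \<times> {..<m})"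
    using card_image[OF inj] by (simp add: card_cartesian_product)
  ultimately have "(\<lambda>k. (k mod n, k mod m)) ` {..<n * m} = {..<n} \<times> {..<m}"
    by (intro card_subset_eq) auto
  with inj show ?thesis by (simp add: bij_betw_def)
qed

text \<open>In general this is not the inverse of the residue map. It is chosen so that a frequency
  \<open>j\<close> times the index, divided by \<open>n * m\<close>, equals
  \<open>j * a / n + j * b / m\<close> up to an integer, without modular inverses.\<close>

definition crt_index :: "nat \<Rightarrow> nat \<Rightarrow> nat \<times> nat \<Rightarrow> nat" where
  "crt_index n m p = (m * fst p + n * snd p) mod (n * m)"

text \<open>Reducing modulo \<open>n\<close> leaves \<open>m * fst p\<close>, and coprimality
  cancels \<open>m\<close>; the second component is symmetric. Counting gives surjectivity.\<close>

lemma bij_betw_crt_index: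
  assumes nm: "coprime n m" and pos: "n > 0" "m > 0"
  shows "bij_betw (crt_index n m) ({..<n} \<times> {..<m}) {..<n * m}"
proof -
  have inj: "inj_on (crt_index n m) ({..<n} \<times> {..<m})"
  proof (rule inj_onI)
    fix p q assume p: "p \<in> {..<n} \<times> {..<m}" and q: "q \<in> {..<n} \<times> {..<m}"
      and "crt_index n m p = crt_index n m q"
    then have c: "[m * fst p + n * snd p = m * fst q + n * snd q] (mod n * m)"
      by (simp add: crt_index_def cong_def)
    have "[m * fst p + n * snd p = m * fst q + n * snd q] (mod n)"
      using c cong_modulus_mult_nat by blast
    then have "[m * fst p = m * fst q] (mod n)"
      by (simp add: cong_def)
    then have "[fst p = fst q] (mod n)"
      using nm by (simp add: cong_mult_lcancel_nat coprime_commute)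
    then have 1: "fst p = fst q" using p q by (auto simp: cong_def)
    have "[m * fst p + n * snd p = m * fst q + n * snd q] (mod m)"
      using c cong_modulus_mult_nat[of _ _ m n] by (simp add: mult.commute)
    then have "[n * snd p = n * snd q] (mod m)"
      by (simp add: cong_def)
    then have "[snd p = snd q] (mod m)"
      using nm by (simp add: cong_mult_lcancel_nat)
    then have "snd p = snd q" using p q by (auto simp: cong_def)
    with 1 show "p = q" by (simp add: prod_eq_iff)
  qed
  have "crt_index n m ` ({..<n} \<times> {..<m}) \<subseteq> {..<n * m}"
    using pos by (auto simp: crt_index_def)
  moreover have "card (crt_index n m ` ({..<n} \<times> {..<m})) = card {..<n * m}"
    using card_image[OF inj] by (simp add: card_cartesian_product)
  ultimately have "crt_index n m ` ({..<n} \<times> {..<m}) = {..<n * m}"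
    by (intro card_subset_eq) auto
  with inj show ?thesis by (simp add: bij_betw_def)
qed

lemma fourier_matrix_symmetric:
  "j < n \<Longrightarrow> k < n \<Longrightarrow> fourier_matrix n $$ (j, k) = fourier_matrix n $$ (k, j)"
  by (simp add: index_fourier_matrix mult_ac)

text \<open>The exponent splits into a part with denominator \<open>n\<close> and one with
  denominator \<open>m\<close>, and each part depends on \<open>j\<close> only through its residue.
  In these coordinates the large Fourier matrix is a tensor product.\<close>

lemma fourier_matrix_crt:
  assumes pos: "n > 0" "m > 0" and j: "j < n * m" and ab: "a < n" "b < m"
  shows "fourier_matrix (n * m) $$ (j, crt_index n m (a, b)) =
    fourier_matrix n $$ (j mod n, a) * fourier_matrix m $$ (j mod m, b)"
proof -
  define x where "x = crt_index n m (a, b)"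
  have x: "x < n * m" using pos by (simp add: x_def crt_index_def)
  have entry: "fourier_matrix k $$ (i, l) =
      cis (2 * pi * of_int (- int (i * l)) / real k) / complex_of_real (sqrt (real k))"
    if "i < k" "l < k" for i k l
    using that by (simp add: index_fourier_matrix mult_ac)
  have red: "cis (2 * pi * of_int (- int (j mod k * l)) / real k) =
      cis (2 * pi * of_int (- int (j * l)) / real k)" if "k > 0" for k l
  proof (rule cis_cong[OF _ that])
    have "[int (j mod k) * int l = int j * int l] (mod int k)"
      by (intro cong_mult cong_refl) (simp add: cong_def zmod_int)
    then show "[- int (j mod k * l) = - int (j * l)] (mod int k)"
      by (simp add: cong_minus_minus_iff)
  qed
  have "[int x = int (m * a + n * b)] (mod int (n * m))"
    unfolding cong_int_iff by (simp add: x_def crt_index_def cong_def)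
  then have "[int j * int x = int j * int (m * a + n * b)] (mod int (n * m))"
    by (intro cong_mult cong_refl)
  then have "[- int (j * x) = - int (j * (m * a + n * b))] (mod int (n * m))"
    by (simp only: cong_minus_minus_iff of_nat_mult)
  from cis_cong[OF this] pos
  have "cis (2 * pi * of_int (- int (j * x)) / real (n * m)) =
      cis (2 * pi * of_int (- int (j * (m * a + n * b))) / real (n * m))" by simp
  also have "2 * pi * of_int (- int (j * (m * a + n * b))) / real (n * m) =
      2 * pi * of_int (- int (j * a)) / real n + 2 * pi * of_int (- int (j * b)) / real m"
    using pos by (simp add: field_simps)
  also have "cis \<dots> = cis (2 * pi * of_int (- int (j mod n * a)) / real n) *
      cis (2 * pi * of_int (- int (j mod m * b)) / real m)"
    unfolding red[OF pos(1)] red[OF pos(2)] by (rule cis_mult[symmetric])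
  finally have num: "cis (2 * pi * of_int (- int (j * x)) / real (n * m)) =
      cis (2 * pi * of_int (- int (j mod n * a)) / real n) *
      cis (2 * pi * of_int (- int (j mod m * b)) / real m)" .
  have "sqrt (real (n * m)) = sqrt (real n) * sqrt (real m)"
    by (simp add: real_sqrt_mult)
  moreover have "j mod n < n" "j mod m < m" using pos by simp_all
  ultimately show ?thesis
    unfolding x_def[symmetric] entry[OF j x] num using ab
    by (simp only: entry of_real_mult times_divide_times_eq)
qed

text \<open>The value type is general because the rule is applied twice: to complex entries of the
  transforms and to their real absolute values.\<close>

lemma sum_product_pairs:
  fixes f :: "'a \<Rightarrow> 'a \<Rightarrow> 'c :: comm_semiring_0" and g :: "'b \<Rightarrow> 'b \<Rightarrow> 'c"
  shows "(\<Sum>p\<in>S \<times> T. \<Sum>q\<in>S \<times> T. f (fst p) (fst q) * g (snd p) (snd q)) =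
    (\<Sum>a\<in>S. \<Sum>c\<in>S. f a c) * (\<Sum>b\<in>T. \<Sum>d\<in>T. g b d)"
proof -
  have "(\<Sum>a\<in>S. \<Sum>c\<in>S. f a c) * (\<Sum>b\<in>T. \<Sum>d\<in>T. g b d) =
      (\<Sum>a\<in>S. \<Sum>b\<in>T. (\<Sum>c\<in>S. f a c) * (\<Sum>d\<in>T. g b d))"
    by (rule sum_product)
  also have "\<dots> = (\<Sum>a\<in>S. \<Sum>b\<in>T. \<Sum>c\<in>S. \<Sum>d\<in>T. f a c * g b d)"
    by (intro sum.cong refl sum_product)
  finally show ?thesis
    by (simp add: sum.cartesian_product')
qed

section \<open>Fourier norms, edge complexity and the energy-gap factor\<close>

lemma edge_complexity_le:
  assumes "finite (pverts G)" "\<sigma> \<in> labelings G"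
  shows "edge_complexity G \<le> fourier_ratio (adj_matrix G \<sigma>)"
  unfolding edge_complexity_def using assms finite_labelings by (intro Min_le) auto

lemma edge_complexity_attained:
  assumes "finite (pverts G)"
  obtains \<sigma> where "\<sigma> \<in> labelings G" "edge_complexity G = fourier_ratio (adj_matrix G \<sigma>)"
proof -
  have "edge_complexity G \<in> (\<lambda>\<sigma>. fourier_ratio (adj_matrix G \<sigma>)) ` labelings G"
    unfolding edge_complexity_def
    using finite_labelings[OF assms] labelings_nonempty[OF assms] by (intro Min_in) auto
  then show thesis using that by auto
qed

text \<open>The numerator of the Fourier ratio, separated because the denominator is the same for
  all labelings of a graph.\<close>

definition fourier_l1 :: "complex mat \<Rightarrow> real" where
  "fourier_l1 M = entrywise_l1_norm (fourier_matrix (dim_row M) * M * fourier_matrix (dim_row M))"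

lemma fourier_ratio_adj_matrix:
  assumes "pair_graph G" "\<sigma> \<in> labelings G"
  shows "fourier_ratio (adj_matrix G \<sigma>) =
    fourier_l1 (adj_matrix G \<sigma>) / sqrt (2 * real (num_edges G))"
proof -
  let ?n = "card (pverts G)" and ?A = "adj_matrix G \<sigma>"
  note U = unitary_fourier_matrix[of ?n]
  have dim: "dim_row ?A = ?n" by (simp add: adj_matrix_def)
  have "frobenius_norm (fourier_matrix ?n * ?A * fourier_matrix ?n) = frobenius_norm (fourier_matrix ?n * ?A)"
    by (rule frobenius_norm_unitary_right[OF U]) (rule mult_carrier_mat[OF fourier_matrix_carrier adj_matrix_carrier])
  also have "\<dots> = frobenius_norm ?A"
    by (rule frobenius_norm_unitary_left[OF U adj_matrix_carrier])
  finally show ?thesis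
    unfolding fourier_ratio_def Let_def fourier_l1_def dim
    by (simp only: frobenius_norm_adj_matrix[OF assms])
qed

lemma fourier_l1_nonneg: "fourier_l1 M \<ge> 0"
  unfolding fourier_l1_def entrywise_l1_norm_def by (intro sum_nonneg norm_ge_zero)

text \<open>At a minimising labeling, the square root in the Fourier ratio cancels against the one
  in the normalised energy; having an edge makes it nonzero.\<close>

lemma energy_gap_factor_eq:
  assumes "pair_graph G" "num_edges G \<ge> 1" "\<sigma> \<in> labelings G"
    "edge_complexity G = fourier_ratio (adj_matrix G \<sigma>)"
  shows "energy_gap_factor G = fourier_l1 (adj_matrix G \<sigma>) / graph_energy G"
  unfolding energy_gap_factor_def assms(4) fourier_ratio_adj_matrix[OF assms(1,3)]
  using assms(2) by simp

lemma energy_gap_factor_le: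
  assumes G: "pair_graph G" and s: "\<sigma> \<in> labelings G" and E: "graph_energy G > 0"
  shows "energy_gap_factor G \<le> fourier_l1 (adj_matrix G \<sigma>) / graph_energy G"
proof (cases "num_edges G = 0")
  \<comment> \<open>Without edges the square root is 0, and division by zero makes the factor 0.
    Covering this case spares a count of the edges of the strong product.\<close>
  case True
  then show ?thesis using E by (simp add: energy_gap_factor_def fourier_l1_nonneg)
next
  case False
  have "energy_gap_factor G \<le>
      fourier_ratio (adj_matrix G \<sigma>) / (graph_energy G / sqrt (2 * real (num_edges G)))"
    unfolding energy_gap_factor_def
    using E by (intro divide_right_mono edge_complexity_le pair_graph_finite G s) simp
  also have "\<dots> = fourier_l1 (adj_matrix G \<sigma>) / graph_energy G"
    unfolding fourier_ratio_adj_matrix[OF G s] using False by simp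
  finally show ?thesis .
qed

lemma card_verts_pos:
  assumes G: "pair_graph G" and "num_edges G \<ge> 1"
  shows "card (pverts G) > 0"
proof -
  have "parcs G \<noteq> {}" using card_arcs_eq[OF G] assms(2) by auto
  then have "pverts G \<noteq> {}" using pair_graph_arc_verts(1)[OF G] by auto
  then show ?thesis using pair_graph_finite(1)[OF G] by (simp add: card_gt_0_iff)
qed

lemma fourier_l1_one: "fourier_l1 (1\<^sub>m n) \<le> real n"
proof -
  have "fourier_matrix n * 1\<^sub>m n = fourier_matrix n"
    by (rule right_mult_one_mat[OF fourier_matrix_carrier])
  then show ?thesis using l1_norm_fourier_square[of n] by (simp add: fourier_l1_def del: right_mult_one_mat)
qed

text \<open>This comparison allows an order \<open>n\<close> to be bounded by \<open>n\<close> times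
  the Fourier norm over the energy, which produces the ratio \<open>order_energy_ratio\<close> in
  the numerator.\<close>

lemma graph_energy_le_fourier_l1:
  assumes "\<sigma> \<in> labelings G"
  shows "graph_energy G \<le> fourier_l1 (adj_matrix G \<sigma>)"
  unfolding graph_energy_eq[OF assms] fourier_l1_def carrier_matD(1)[OF adj_matrix_carrier]
  by (rule matrix_energy_le_l1_norm[OF adj_matrix_carrier unitary_fourier_matrix unitary_fourier_matrix])

lemma graph_energy_pos:
  assumes G: "pair_graph G" and e: "num_edges G \<ge> 1"
  shows "graph_energy G > 0"
proof -
  obtain \<sigma> where s: "\<sigma> \<in> labelings G"
    using labelings_nonempty[OF pair_graph_finite(1)[OF G]] by auto
  have "frobenius_norm (adj_matrix G \<sigma>) \<noteq> 0"
    using frobenius_norm_adj_matrix[OF G s] e by simp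
  then show ?thesis
    unfolding graph_energy_eq[OF s]
    by (rule matrix_energy_pos[OF adj_matrix_carrier mat_adjoint_adj_matrix[OF G s]])
qed

text \<open>Under the labeling by \<open>crt_index\<close>, each entry of the transform is a sum of
  three products of entries at the residues of the two frequencies. After the triangle inequality,
  summation over all frequencies is summation over pairs of residues, so each product of absolute
  values factors; the two transformed identities contribute at most the orders.\<close>

lemma fourier_l1_strong_product_le:
  assumes G: "pair_graph G" and H: "pair_graph H"
    and s: "\<sigma> \<in> labelings G" and t: "\<tau> \<in> labelings H"
    and cop: "coprime (card (pverts G)) (card (pverts H))"
    and pos: "card (pverts G) > 0" "card (pverts H) > 0"
  obtains \<rho> where "\<rho> \<in> labelings (strong_product G H)"
    and "fourier_l1 (adj_matrix (strong_product G H) \<rho>) \<le>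
      fourier_l1 (adj_matrix G \<sigma>) * fourier_l1 (adj_matrix H \<tau>) +
      fourier_l1 (adj_matrix G \<sigma>) * real (card (pverts H)) +
      real (card (pverts G)) * fourier_l1 (adj_matrix H \<tau>)"
proof -
  define n m where "n = card (pverts G)" and "m = card (pverts H)"
  define A B where "A = adj_matrix G \<sigma>" and "B = adj_matrix H \<tau>"
  note bij = bij_betw_crt_index[OF cop pos, folded n_def m_def]
  note cop' = cop[folded n_def m_def] and pos' = pos[folded n_def m_def]
  obtain \<rho> where r: "\<rho> \<in> labelings (strong_product G H)"
    and adj: "\<And>a b c d. \<lbrakk>a < n; b < m; c < n; d < m\<rbrakk> \<Longrightarrow>
      adj_matrix (strong_product G H) \<rho> $$ (crt_index n m (a, b), crt_index n m (c, d)) =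
        A $$ (a, c) * B $$ (b, d) + A $$ (a, c) * of_bool (b = d) + of_bool (a = c) * B $$ (b, d)"
    using strong_product_labeling[OF G H s t bij[unfolded n_def m_def]]
    unfolding n_def m_def A_def B_def by blast
  define M where "M = adj_matrix (strong_product G H) \<rho>"
  have A: "A \<in> carrier_mat n n" and B: "B \<in> carrier_mat m m"
    by (simp_all add: A_def B_def n_def m_def)
  have M: "M \<in> carrier_mat (n * m) (n * m)"
    using adj_matrix_carrier[of "strong_product G H" \<rho>]
    by (simp add: M_def n_def m_def strong_product_def card_cartesian_product)
  define F where "F = (\<lambda>k X. fourier_matrix k * X * fourier_matrix k)"
  have Fc: "F k X \<in> carrier_mat k k" if "X \<in> carrier_mat k k" for k X
    unfolding F_def by (rule mult_carrier_mat[OF mult_carrier_mat[OF fourier_matrix_carrier that] fourier_matrix_carrier])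
  have Fl1: "fourier_l1 X = (\<Sum>x<k. \<Sum>y<k. cmod (F k X $$ (x, y)))" if "X \<in> carrier_mat k k" for k X
    using carrier_matD[OF Fc[OF that]] carrier_matD[OF that]
    by (simp only: fourier_l1_def entrywise_l1_norm_def F_def)
  let ?I = "{..<n} \<times> {..<m}"
  \<comment> \<open>One summand of the product of the transforms of \<open>X\<close> and
    \<open>Y\<close>, for vertex pairs \<open>p\<close> and \<open>q\<close>; the three terms of the
    adjacency formula use it with \<open>1\<^sub>m\<close> in one slot or none.\<close>
  define h where "h = (\<lambda>X Y j k p q. (fourier_matrix n $$ (j mod n, fst p) * X $$ (fst p, fst q) * fourier_matrix n $$ (fst q, k mod n)) *
        (fourier_matrix m $$ (j mod m, snd p) * Y $$ (snd p, snd q) * fourier_matrix m $$ (snd q, k mod m)))"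
  have prod: "(\<Sum>p\<in>?I. \<Sum>q\<in>?I. h X Y j k p q) = F n X $$ (j mod n, k mod n) * F m Y $$ (j mod m, k mod m)"
    if X: "X \<in> carrier_mat n n" and Y: "Y \<in> carrier_mat m m" for X Y j k
  proof -
    have lt: "j mod n < n" "k mod n < n" "j mod m < m" "k mod m < m" using pos' by simp_all
    show ?thesis
      unfolding F_def h_def
        index_mult_mat3[OF fourier_matrix_carrier X fourier_matrix_carrier lt(1,2)]
        index_mult_mat3[OF fourier_matrix_carrier Y fourier_matrix_carrier lt(3,4)]
      by (rule sum_product_pairs)
  qed
  have one: "(1\<^sub>m n :: complex mat) \<in> carrier_mat n n" "(1\<^sub>m m :: complex mat) \<in> carrier_mat m m" by simp_all
  have entry: "F (n * m) M $$ (j, k) = F n A $$ (j mod n, k mod n) * F m B $$ (j mod m, k mod m) +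
      F n A $$ (j mod n, k mod n) * F m (1\<^sub>m m) $$ (j mod m, k mod m) +
      F n (1\<^sub>m n) $$ (j mod n, k mod n) * F m B $$ (j mod m, k mod m)"
    if j: "j < n * m" and k: "k < n * m" for j k
  proof -
    have "F (n * m) M $$ (j, k) = (\<Sum>x<n * m. \<Sum>y<n * m.
        fourier_matrix (n * m) $$ (j, x) * M $$ (x, y) * fourier_matrix (n * m) $$ (y, k))"
      unfolding F_def by (rule index_mult_mat3[OF fourier_matrix_carrier M fourier_matrix_carrier j k])
    also have "\<dots> = (\<Sum>p\<in>?I. \<Sum>q\<in>?I. fourier_matrix (n * m) $$ (j, crt_index n m p) *
        M $$ (crt_index n m p, crt_index n m q) * fourier_matrix (n * m) $$ (crt_index n m q, k))"
      by (simp only: sum.reindex_bij_betw[OF bij, symmetric])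
    also have "\<dots> = (\<Sum>p\<in>?I. \<Sum>q\<in>?I. h A B j k p q + h A (1\<^sub>m m) j k p q + h (1\<^sub>m n) B j k p q)"
    proof (intro sum.cong refl)
      fix p q assume "p \<in> ?I" "q \<in> ?I"
      then obtain a b c d where pq: "p = (a, b)" "q = (c, d)" and ab: "a < n" "b < m" and cd: "c < n" "d < m"
        by auto
      have lt: "k mod n < n" "k mod m < m" using pos' by simp_all
      have cr: "crt_index n m (c, d) < n * m" using pos' by (simp add: crt_index_def)
      have Fj: "fourier_matrix (n * m) $$ (j, crt_index n m (a, b)) =
          fourier_matrix n $$ (j mod n, a) * fourier_matrix m $$ (j mod m, b)"
        by (rule fourier_matrix_crt[OF pos' j ab])
      \<comment> \<open>In the right-hand Fourier factor the vertex index is the row, so symmetry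
        moves it to the column before and back after the splitting.\<close>
      have Fk: "fourier_matrix (n * m) $$ (crt_index n m (c, d), k) =
          fourier_matrix n $$ (c, k mod n) * fourier_matrix m $$ (d, k mod m)"
        unfolding fourier_matrix_symmetric[OF cr k] fourier_matrix_crt[OF pos' k cd]
          fourier_matrix_symmetric[OF cd(1) lt(1)] fourier_matrix_symmetric[OF cd(2) lt(2)] ..
      have I: "(1\<^sub>m n :: complex mat) $$ (a, c) = of_bool (a = c)" "(1\<^sub>m m :: complex mat) $$ (b, d) = of_bool (b = d)"
        using ab cd by simp_all
      show "fourier_matrix (n * m) $$ (j, crt_index n m p) *
          M $$ (crt_index n m p, crt_index n m q) * fourier_matrix (n * m) $$ (crt_index n m q, k) =
          h A B j k p q + h A (1\<^sub>m m) j k p q + h (1\<^sub>m n) B j k p q"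
        unfolding pq Fj Fk M_def adj[OF ab cd] h_def fst_conv snd_conv I
        by (simp only: ring_distribs mult_ac)
    qed
    also have "\<dots> = (\<Sum>p\<in>?I. \<Sum>q\<in>?I. h A B j k p q) + (\<Sum>p\<in>?I. \<Sum>q\<in>?I. h A (1\<^sub>m m) j k p q) +
        (\<Sum>p\<in>?I. \<Sum>q\<in>?I. h (1\<^sub>m n) B j k p q)"
      by (simp only: sum.distrib)
    finally show ?thesis
      unfolding prod[OF A B] prod[OF A one(2)] prod[OF one(1) B] .
  qed
  note res = bij_betw_residues[OF cop']
  have norm_prod: "(\<Sum>j<n * m. \<Sum>k<n * m. cmod (F n X $$ (j mod n, k mod n)) * cmod (F m Y $$ (j mod m, k mod m))) =
      fourier_l1 X * fourier_l1 Y" if X: "X \<in> carrier_mat n n" and Y: "Y \<in> carrier_mat m m" for X Y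
  proof -
    have "(\<Sum>j<n * m. \<Sum>k<n * m. cmod (F n X $$ (j mod n, k mod n)) * cmod (F m Y $$ (j mod m, k mod m))) =
        (\<Sum>p\<in>?I. \<Sum>q\<in>?I. cmod (F n X $$ (fst p, fst q)) * cmod (F m Y $$ (snd p, snd q)))"
      by (simp only: sum.reindex_bij_betw[OF res, symmetric] fst_conv snd_conv)
    also have "\<dots> = fourier_l1 X * fourier_l1 Y"
      unfolding Fl1[OF X] Fl1[OF Y] by (rule sum_product_pairs)
    finally show ?thesis .
  qed
  have "fourier_l1 M = (\<Sum>j<n * m. \<Sum>k<n * m. cmod (F (n * m) M $$ (j, k)))"
    by (rule Fl1[OF M])
  also have "\<dots> \<le> (\<Sum>j<n * m. \<Sum>k<n * m.
      cmod (F n A $$ (j mod n, k mod n)) * cmod (F m B $$ (j mod m, k mod m)) +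
      cmod (F n A $$ (j mod n, k mod n)) * cmod (F m (1\<^sub>m m) $$ (j mod m, k mod m)) +
      cmod (F n (1\<^sub>m n) $$ (j mod n, k mod n)) * cmod (F m B $$ (j mod m, k mod m)))"
    unfolding norm_mult[symmetric]
  proof (intro sum_mono)
    fix j k assume "j \<in> {..<n * m}" "k \<in> {..<n * m}"
    then have jk: "j < n * m" "k < n * m" by simp_all
    show "cmod (F (n * m) M $$ (j, k)) \<le>
      cmod (F n A $$ (j mod n, k mod n) * F m B $$ (j mod m, k mod m)) +
      cmod (F n A $$ (j mod n, k mod n) * F m (1\<^sub>m m) $$ (j mod m, k mod m)) +
      cmod (F n (1\<^sub>m n) $$ (j mod n, k mod n) * F m B $$ (j mod m, k mod m))"
      unfolding entry[OF jk]
      by (rule order_trans[OF norm_triangle_ineq add_right_mono[OF norm_triangle_ineq]])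
  qed
  also have "\<dots> = fourier_l1 A * fourier_l1 B + fourier_l1 A * fourier_l1 (1\<^sub>m m) + fourier_l1 (1\<^sub>m n) * fourier_l1 B"
    by (simp only: sum.distrib norm_prod[OF A B] norm_prod[OF A one(2)] norm_prod[OF one(1) B])
  also have "\<dots> \<le> fourier_l1 A * fourier_l1 B + fourier_l1 A * real m + real n * fourier_l1 B"
    by (intro add_mono mult_left_mono mult_right_mono fourier_l1_one fourier_l1_nonneg order_refl)
  finally show thesis
    using that[OF r] unfolding M_def A_def B_def n_def m_def by blast
qed

theorem proposition3p9:
  fixes G :: "'a pair_pre_digraph" and H :: "'b pair_pre_digraph"
  assumes "pair_graph G" and "pair_graph H"
    and "num_edges G \<ge> 1" and "num_edges H \<ge> 1"
  shows "graph_energy (strong_product G H) \<ge>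
           graph_energy G * graph_energy H * (1 - order_energy_ratio G H) \<and>
         (coprime (card (pverts G)) (card (pverts H)) \<and> order_energy_ratio G H < 1 \<longrightarrow>
           energy_gap_factor (strong_product G H) \<le>
             energy_gap_factor G * energy_gap_factor H *
             ((1 + order_energy_ratio G H) / (1 - order_energy_ratio G H)))"
proof -
  define n m E1 E2 r where "n = real (card (pverts G))" and "m = real (card (pverts H))"
    and "E1 = graph_energy G" and "E2 = graph_energy H" and "r = order_energy_ratio G H"
  define E where "E = graph_energy (strong_product G H)"
  have E1: "E1 > 0" and E2: "E2 > 0"
    unfolding E1_def E2_def using assms by (auto intro: graph_energy_pos)
  have r: "r = n / E1 + m / E2"
    by (simp add: r_def order_energy_ratio_def n_def m_def E1_def E2_def)
  have "E1 * E2 * (1 - r) = E1 * E2 - m * E1 - n * E2"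
    using E1 E2 by (simp add: r field_simps)
  then have lower: "E \<ge> E1 * E2 * (1 - r)"
    using graph_energy_strong_product_ge[OF assms(1,2)]
    by (simp add: E_def E1_def E2_def n_def m_def)
  have "energy_gap_factor (strong_product G H) \<le>
      energy_gap_factor G * energy_gap_factor H * ((1 + r) / (1 - r))"
    if cop: "coprime (card (pverts G)) (card (pverts H))" and r1: "r < 1"
  proof -
    \<comment> \<open>Minimising labelings are taken for the two factors only; for the product, the
      labeling built from them merely bounds the minimum from above.\<close>
    obtain \<sigma> where s: "\<sigma> \<in> labelings G" "edge_complexity G = fourier_ratio (adj_matrix G \<sigma>)"
      by (rule edge_complexity_attained[OF pair_graph_finite(1)[OF assms(1)]])
    obtain \<tau> where t: "\<tau> \<in> labelings H" "edge_complexity H = fourier_ratio (adj_matrix H \<tau>)"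
      by (rule edge_complexity_attained[OF pair_graph_finite(1)[OF assms(2)]])
    define a b where "a = fourier_l1 (adj_matrix G \<sigma>)" and "b = fourier_l1 (adj_matrix H \<tau>)"
    have a: "a \<ge> E1" and b: "b \<ge> E2"
      unfolding a_def b_def E1_def E2_def by (rule graph_energy_le_fourier_l1 s(1) t(1))+
    have pos: "card (pverts G) > 0" "card (pverts H) > 0"
      using assms by (auto intro: card_verts_pos)
    obtain \<rho> where \<rho>: "\<rho> \<in> labelings (strong_product G H)"
      and le: "fourier_l1 (adj_matrix (strong_product G H) \<rho>) \<le> a * b + a * m + n * b"
      using fourier_l1_strong_product_le[OF assms(1,2) s(1) t(1) cop pos]
      unfolding a_def b_def n_def m_def .
    \<comment> \<open>Here \<open>r < 1\<close> turns the energy bound into positivity, which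
      justifies dividing by \<open>E\<close>.\<close>
    have E: "E > 0"
      by (rule less_le_trans[OF _ lower]) (use E1 E2 r1 in simp)
    \<comment> \<open>Because \<open>a\<close> and \<open>b\<close> dominate the energies, the error
      terms \<open>a * m\<close> and \<open>n * b\<close> are absorbed into
      \<open>a * b * r\<close>.\<close>
    have "m \<le> b * m / E2" "n \<le> a * n / E1"
      using a b E1 E2 pos by (simp_all add: field_simps n_def m_def)
    then have "a * m + n * b \<le> a * (b * m / E2) + (a * n / E1) * b"
      using a b E1 E2 by (intro add_mono mult_left_mono mult_right_mono) auto
    also have "\<dots> = a * b * r"
      by (simp add: r algebra_simps)
    finally have "a * b + a * m + n * b \<le> a * b * (1 + r)"
      by (simp add: algebra_simps)
    with le have num: "fourier_l1 (adj_matrix (strong_product G H) \<rho>) \<le> a * b * (1 + r)"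
      by linarith
    have "energy_gap_factor (strong_product G H) \<le> fourier_l1 (adj_matrix (strong_product G H) \<rho>) / E"
      unfolding E_def
      by (rule energy_gap_factor_le[OF pair_graph_strong_product[OF assms(1,2)] \<rho> E[unfolded E_def]])
    also have "\<dots> \<le> (a * b * (1 + r)) / (E1 * E2 * (1 - r))"
      by (rule frac_le[OF _ num _ lower])
        (use num E1 E2 r1 a b fourier_l1_nonneg[of "adj_matrix (strong_product G H) \<rho>"] in auto)
    also have "\<dots> = (a / E1) * (b / E2) * ((1 + r) / (1 - r))"
      by simp
    also have "a / E1 = energy_gap_factor G"
      unfolding a_def E1_def by (rule energy_gap_factor_eq[OF assms(1,3) s, symmetric])
    also have "b / E2 = energy_gap_factor H"
      unfolding b_def E2_def by (rule energy_gap_factor_eq[OF assms(2,4) t, symmetric])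
    finally show ?thesis .
  qed
  then show ?thesis
    using lower by (simp add: E_def E1_def E2_def r_def)
qed

end
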